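(* Let $(X,\mathbb{P})$ be an $\alpha$-self-similar Markov process on $[0,\infty[$ ($\alpha>0$) that hits $0$ in a $\mathbb{P}$-a.s. finite time and dies there. Let $\mathrm{n}$ be a self-similar excursion measure compatible with $(X,\mathbb{P})$ and with index of self-similarity $\gamma\in\,]0,1[$. Then $$\text{either } \mathrm{n}(X_{0+}>0)=0\quad\text{or}\quad \mathrm{n}(X_{0+}=0)=0.$$
   Context: Setting. $\mathbb{D}^+$ is the Skorohod space of càdlàg paths $[0,\infty[\to\mathbb{R}^+$ with its Borel $\sigma$-field, $X$ is the canonical process, $(\mathcal{G}_t,t\ge 0)$ its natural filtration. $\mathbb{P}=(\mathbb{P}_x,x\ge 0)$ is a family of probability measures on $\mathbb{D}^+$ such that $(X,\mathbb{P})$ is a positive self-similar Markov process: a $[0,\infty[$-valued strong Markov process such that, for some $\alpha>0$ and every $c>0$, $x\ge 0$, the law of $(cX_{tc^{-1/\alpha}},t\ge 0)$ under $\mathbb{P}_x$ equals the law of $(X_t,t\ge 0)$ under $\mathbb{P}_{cx}$. It is assumed that $T_0=\inf\{t>0: X_t=0\}$ is finite $\mathbb{P}$-a.s. and that $X$ stays at $0$ from time $T_0$ on; $\mathbb{P}_0$ is the law of the path identically $0$. Excursion measures. A $\sigma$-finite measure $\mathrm{n}$ on $(\mathbb{D}^+,\mathcal{G}_\infty)$ having infinite mass is an excursion measure compatible with $(X,\mathbb{P})$ if: (i) $\mathrm{n}$ is carried by $\{\omega\in\mathbb{D}^+ : T_0(\omega)>0 \text{ and } X_t(\omega)=0\ \forall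 t\ge T_0\}$; (ii) for every bounded $\mathcal{G}_\infty$-measurable $H$, each $t>0$ and $\Lambda\in\mathcal{G}_t$, $\mathrm{n}(H\circ s_t,\Lambda\cap\{t<T_0\})=\mathrm{n}(\mathbb{E}_{X_t}(H),\Lambda\cap\{t<T_0\})$, where $s_t$ is the shift operator and $\mathrm{n}(Y,A)=\int_A Y\,d\mathrm{n}$; (iii) $\mathrm{n}(1-e^{-T_0})<\infty$. It is self-similar with index of self-similarity $\gamma\in\,]0,1[$ if for all $a>0$ the image $H_a\mathrm{n}$ of $\mathrm{n}$ under the map $H_a:\mathbb{D}^+\to\mathbb{D}^+$, $H_a(\omega)(t)=a\,\omega(a^{-1/\alpha}t)$, $t\ge0$, satisfies $H_a\mathrm{n}=a^{\gamma/\alpha}\mathrm{n}$. *)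

theory Defs
  imports "HOL-Probability.Probability"
begin

section \<open>Path space\<close>

text \<open>
  A path is a function on \<open>{0..}\<close>, represented by an extensional function \<^typ>\<open>real \<Rightarrow> real\<close>
  (it takes the value \<^const>\<open>undefined\<close> at negative times), so that paths that agree at all times
  \<open>t \<ge> 0\<close> are equal.
\<close>

type_synonym path = "real \<Rightarrow> real"

definition cadlag_paths :: "path set" where
  "cadlag_paths = {\<omega> \<in> extensional {0..}.
     (\<forall>t\<ge>0. 0 \<le> \<omega> t) \<and>
     (\<forall>t\<ge>0. continuous (at_right t) \<omega>) \<and>
     (\<forall>t>0. \<exists>l. (\<omega> \<longlongrightarrow> l) (at_left t))}"

text \<open>
  The natural filtration \<open>\<G>\<^sub>t = \<sigma>(X\<^sub>s, s \<le> t)\<close> of the canonical process, indexed by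
  \<open>t \<in> [0, \<infinity>]\<close>.  The member \<open>\<G> \<infinity> = \<sigma>(X\<^sub>s, s \<ge> 0)\<close> coincides with the Borel
  \<sigma>-field of the Skorohod topology.
\<close>

definition natural_filtration :: "ennreal \<Rightarrow> path measure" ("\<G>") where
  "\<G> t = sigma cadlag_paths
     {{\<omega> \<in> cadlag_paths. \<omega> s \<in> B} | s B. 0 \<le> s \<and> ennreal s \<le> t \<and> B \<in> sets borel}"

definition shift_path :: "real \<Rightarrow> path \<Rightarrow> path" where
  "shift_path t \<omega> = (\<lambda>u\<in>{0..}. \<omega> (t + u))"

definition scale_path :: "real \<Rightarrow> real \<Rightarrow> path \<Rightarrow> path" where
  "scale_path \<alpha> a \<omega> = (\<lambda>t\<in>{0..}. a * \<omega> (a powr (- 1 / \<alpha>) * t))"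

definition zero_path :: path where
  "zero_path = (\<lambda>t\<in>{0..}. 0)"

text \<open>The infimum of the empty set is \<open>\<infinity>\<close> in \<^typ>\<open>ennreal\<close>.\<close>

definition hit_zero :: "path \<Rightarrow> ennreal" ("T\<^sub>0") where
  "T\<^sub>0 \<omega> = Inf (ennreal ` {t. 0 < t \<and> \<omega> t = 0})"

definition right_limit_0 :: "path \<Rightarrow> real" ("X\<^sub>0\<^sub>+") where
  "X\<^sub>0\<^sub>+ \<omega> = Lim (at_right 0) \<omega>"

definition one_minus_exp :: "ennreal \<Rightarrow> real" where
  "one_minus_exp t = (if t = \<infinity> then 1 else 1 - exp (- enn2real t))"


section \<open>Positive self-similar Markov processes\<close>

definition bounded_measurable :: "(path \<Rightarrow> real) \<Rightarrow> bool" where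
  "bounded_measurable H \<longleftrightarrow> H \<in> borel_measurable (\<G> \<infinity>) \<and> bounded (H ` cadlag_paths)"

text \<open>
  The strong Markov property refers to the stopping times \<open>T\<close> of the natural filtration, with values
  in \<open>[0, \<infinity>]\<close>, and is stated by integrating over the sets of
  \<open>\<G>\<^sub>T\<close> (\<^const>\<open>filtration.pre_sigma\<close>).
\<close>

definition strong_markov :: "(real \<Rightarrow> path measure) \<Rightarrow> bool" where
  "strong_markov P \<longleftrightarrow>
     P \<in> restrict_space borel {0..} \<rightarrow>\<^sub>M prob_algebra (\<G> \<infinity>) \<and>
     (\<forall>x\<ge>0. AE \<omega> in P x. \<omega> 0 = x) \<and>
     (\<forall>x\<ge>0. \<forall>T H. \<forall>A \<in> sets (filtration.pre_sigma cadlag_paths \<G> T).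
        stopping_time \<G> T \<longrightarrow> bounded_measurable H \<longrightarrow>
        (LINT \<omega> : A \<inter> {\<omega>. T \<omega> < \<infinity>} | P x. H (shift_path (enn2real (T \<omega>)) \<omega>)) =
        (LINT \<omega> : A \<inter> {\<omega>. T \<omega> < \<infinity>} | P x. (LINT \<eta> | P (\<omega> (enn2real (T \<omega>))). H \<eta>)))"

definition pssMp :: "real \<Rightarrow> (real \<Rightarrow> path measure) \<Rightarrow> bool" where
  "pssMp \<alpha> P \<longleftrightarrow> 0 < \<alpha> \<and> strong_markov P \<and>
     (\<forall>c>0. \<forall>x\<ge>0. distr (P x) (\<G> \<infinity>) (scale_path \<alpha> c) = P (c * x))"

definition dies_at_zero :: "(real \<Rightarrow> path measure) \<Rightarrow> bool" where
  "dies_at_zero P \<longleftrightarrow>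
     (\<forall>x\<ge>0. AE \<omega> in P x. T\<^sub>0 \<omega> < \<infinity>) \<and>
     (\<forall>x\<ge>0. AE \<omega> in P x. \<forall>t\<ge>0. T\<^sub>0 \<omega> \<le> ennreal t \<longrightarrow> \<omega> t = 0) \<and>
     P 0 = return (\<G> \<infinity>) zero_path"


section \<open>Excursion measures\<close>

text \<open>
  On the whole path space \<^const>\<open>hit_zero\<close> need not be measurable for \<^term>\<open>\<G> \<infinity>\<close>, but on the set
  that carries an excursion measure \<open>{t < T\<^sub>0} = {X\<^sub>t > 0}\<close> for \<open>t > 0\<close>.  Integrals involving
  \<^const>\<open>hit_zero\<close> are therefore taken with respect to the completion of the measure, and
  ``carried by'' means that the complement is contained in a null set.
\<close>

definition excursion_measure :: "(real \<Rightarrow> path measure) \<Rightarrow> path measure \<Rightarrow> bool" where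
  "excursion_measure P n \<longleftrightarrow>
     sets n = sets (\<G> \<infinity>) \<and> sigma_finite_measure n \<and> emeasure n (space n) = \<infinity> \<and>
     (AE \<omega> in n. 0 < T\<^sub>0 \<omega> \<and> (\<forall>t\<ge>0. T\<^sub>0 \<omega> \<le> ennreal t \<longrightarrow> \<omega> t = 0)) \<and>
     (\<forall>H. \<forall>t>0. \<forall>\<Lambda> \<in> sets (\<G> (ennreal t)). bounded_measurable H \<longrightarrow>
        (LINT \<omega> : \<Lambda> \<inter> {\<omega>. ennreal t < T\<^sub>0 \<omega>} | completion n. H (shift_path t \<omega>)) =
        (LINT \<omega> : \<Lambda> \<inter> {\<omega>. ennreal t < T\<^sub>0 \<omega>} | completion n. (LINT \<eta> | P (\<omega> t). H \<eta>))) \<and>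
     (\<integral>\<^sup>+ \<omega>. ennreal (one_minus_exp (T\<^sub>0 \<omega>)) \<partial>completion n) < \<infinity>"

definition self_similar_measure :: "real \<Rightarrow> real \<Rightarrow> path measure \<Rightarrow> bool" where
  "self_similar_measure \<alpha> \<gamma> n \<longleftrightarrow>
     (\<forall>a>0. distr n (\<G> \<infinity>) (scale_path \<alpha> a) = scale_measure (ennreal (a powr (\<gamma> / \<alpha>))) n)"


section \<open>Well-definedness\<close>

lemma space_natural_filtration [simp]: "space (\<G> t) = cadlag_paths"
  unfolding natural_filtration_def by (rule space_measure_of) auto

lemma sets_natural_filtration:
  "sets (\<G> t) = sigma_sets cadlag_paths
     {{\<omega> \<in> cadlag_paths. \<omega> s \<in> B} | s B. 0 \<le> s \<and> ennreal s \<le> t \<and> B \<in> sets borel}"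
  unfolding natural_filtration_def by (rule sets_measure_of) auto

lemma filtration_natural_filtration: "filtration cadlag_paths \<G>"
proof
  show "space (\<G> i) = cadlag_paths" for i
    by simp
  show "sets (\<G> i) \<subseteq> sets (\<G> j)" if "i \<le> j" for i j
    unfolding sets_natural_filtration
    by (rule sigma_sets_mono') (use that in \<open>blast intro: order_trans\<close>)
qed

lemma measurable_coordinate:
  assumes "0 \<le> s" "ennreal s \<le> t"
  shows "(\<lambda>\<omega>. \<omega> s) \<in> borel_measurable (\<G> t)"
proof (rule measurableI)
  fix B :: "real set" assume "B \<in> sets borel"
  then have "{\<omega> \<in> cadlag_paths. \<omega> s \<in> B} \<in> sets (\<G> t)"
    unfolding sets_natural_filtration using assms by (intro sigma_sets.Basic) blast
  then show "(\<lambda>\<omega>. \<omega> s) -` B \<inter> space (\<G> t) \<in> sets (\<G> t)"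
    by (simp add: vimage_def Int_def conj_commute)
qed simp

lemma measurable_into_paths:
  assumes "f \<in> space M \<rightarrow> cadlag_paths"
    and "\<And>s. 0 \<le> s \<Longrightarrow> (\<lambda>x. f x s) \<in> borel_measurable M"
  shows "f \<in> M \<rightarrow>\<^sub>M \<G> \<infinity>"
  unfolding natural_filtration_def
proof (rule measurable_measure_of)
  fix A assume "A \<in> {{\<omega> \<in> cadlag_paths. \<omega> s \<in> B} | s B. 0 \<le> s \<and> ennreal s \<le> \<infinity> \<and> B \<in> sets borel}"
  then obtain s and B :: "real set"
    where A: "A = {\<omega> \<in> cadlag_paths. \<omega> s \<in> B}" "0 \<le> s" "B \<in> sets borel"
    by blast
  then have "f -` A \<inter> space M = (\<lambda>x. f x s) -` B \<inter> space M"
    using assms(1) by auto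
  also have "\<dots> \<in> sets M"
    using assms(2)[OF A(2)] A(3) by (rule measurable_sets)
  finally show "f -` A \<inter> space M \<in> sets M" .
qed (use assms(1) in auto)

lemma cadlag_paths_affine:
  assumes \<omega>: "\<omega> \<in> cadlag_paths" and "0 \<le> a" "0 < b" "0 \<le> c"
  shows "(\<lambda>t\<in>{0..}. a * \<omega> (b * t + c)) \<in> cadlag_paths"
proof -
  let ?f = "\<lambda>t\<in>{0..}. a * \<omega> (b * t + c)"
  have 1: "continuous (at_right t) ?f" if t: "0 \<le> t" for t
  proof -
    have "(\<omega> \<longlongrightarrow> \<omega> (b * t + c)) (at_right (b * t + c))"
      using \<omega> t assms by (auto simp: cadlag_paths_def continuous_within)
    moreover have "filterlim (\<lambda>s. b * s + c) (at_right (b * t + c)) (at_right t)"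
      unfolding filterlim_at using \<open>0 < b\<close>
      by (auto intro!: tendsto_eq_intros simp: eventually_at_topological)
    ultimately have "((\<lambda>s. a * \<omega> (b * s + c)) \<longlongrightarrow> a * \<omega> (b * t + c)) (at_right t)"
      by (intro tendsto_mult tendsto_const) (rule filterlim_compose)
    then have "(?f \<longlongrightarrow> a * \<omega> (b * t + c)) (at_right t)"
      by (rule Lim_transform_eventually) (use t in \<open>auto simp: eventually_at_filter\<close>)
    then show ?thesis
      using t by (simp add: continuous_within)
  qed
  have 2: "\<exists>l. (?f \<longlongrightarrow> l) (at_left t)" if t: "0 < t" for t
  proof -
    have "0 < b * t + c"
      using t assms by (simp add: add_pos_nonneg)
    then obtain l where "(\<omega> \<longlongrightarrow> l) (at_left (b * t + c))"
      using \<omega> by (auto simp: cadlag_paths_def)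
    moreover have "filterlim (\<lambda>s. b * s + c) (at_left (b * t + c)) (at_left t)"
      unfolding filterlim_at using \<open>0 < b\<close>
      by (auto intro!: tendsto_eq_intros simp: eventually_at_topological)
    ultimately have "((\<lambda>s. a * \<omega> (b * s + c)) \<longlongrightarrow> a * l) (at_left t)"
      by (intro tendsto_mult tendsto_const) (rule filterlim_compose)
    moreover have "\<forall>\<^sub>F s in at_left t. a * \<omega> (b * s + c) = ?f s"
      using eventually_at_left_real[OF t] by eventually_elim auto
    ultimately show ?thesis
      by (blast intro: Lim_transform_eventually)
  qed
  show ?thesis
    using 1 2 \<omega> assms unfolding cadlag_paths_def by auto
qed

lemma measurable_shift_path:
  assumes "0 \<le> t" shows "shift_path t \<in> \<G> \<infinity> \<rightarrow>\<^sub>M \<G> \<infinity>"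
proof (rule measurable_into_paths)
  show "shift_path t \<in> space (\<G> \<infinity>) \<rightarrow> cadlag_paths"
    using cadlag_paths_affine[where a = 1 and b = 1 and c = t] assms
    by (auto simp: shift_path_def add.commute)
  show "(\<lambda>\<omega>. shift_path t \<omega> s) \<in> borel_measurable (\<G> \<infinity>)" if "0 \<le> s" for s
    using measurable_coordinate[of "t + s" \<infinity>] assms that by (simp add: shift_path_def)
qed

lemma measurable_scale_path:
  assumes "0 < a" shows "scale_path \<alpha> a \<in> \<G> \<infinity> \<rightarrow>\<^sub>M \<G> \<infinity>"
proof (rule measurable_into_paths)
  show "scale_path \<alpha> a \<in> space (\<G> \<infinity>) \<rightarrow> cadlag_paths"
    using cadlag_paths_affine[where a = a and b = "a powr (- 1 / \<alpha>)" and c = 0] assms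
    by (auto simp: scale_path_def)
  show "(\<lambda>\<omega>. scale_path \<alpha> a \<omega> s) \<in> borel_measurable (\<G> \<infinity>)" if "0 \<le> s" for s
    using measurable_coordinate[of "a powr (- 1 / \<alpha>) * s" \<infinity>] that
    by (simp add: scale_path_def)
qed

lemma right_limit_0_eq: "\<omega> \<in> cadlag_paths \<Longrightarrow> X\<^sub>0\<^sub>+ \<omega> = \<omega> 0"
  unfolding right_limit_0_def cadlag_paths_def
  by (intro tendsto_Lim) (auto simp: continuous_within)

lemma measurable_right_limit_0: "X\<^sub>0\<^sub>+ \<in> borel_measurable (\<G> \<infinity>)"
  using measurable_coordinate[of 0 \<infinity>]
  by (subst measurable_cong[where g = "\<lambda>\<omega>. \<omega> 0"]) (auto simp: right_limit_0_eq)

end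

theory Submission
  imports Defs
begin

text \<open>
  Suppose that the restrictions \<open>m\<^sub>1\<close> and \<open>m\<^sub>2\<close> of \<open>n\<close> to \<open>{X\<^sub>0\<^sub>+ > 0}\<close> and \<open>{X\<^sub>0\<^sub>+ = 0}\<close> are both
  non-zero.  Both are self-similar with index \<open>\<gamma>\<close>, so their potentials
  \<open>B \<mapsto> m\<^sub>i(\<integral> 1{X\<^sub>t \<in> B, t < T\<^sub>0} dt)\<close> scale in the same way and, by uniqueness of Haar measure on
  the multiplicative group of positive reals, are proportional.  By the Markov property the potential
  determines \<open>m\<^sub>i(\<integral> H \<circ> s\<^sub>t dt)\<close> for every functional \<open>H\<close>.  Subtracting this
  quantity for \<open>G \<circ> s\<^sub>s\<close> from the one for \<open>G\<close> gives \<open>m\<^sub>i(\<integral>\<^sub>0\<^sup>s G \<circ> s\<^sub>t dt)\<close>; dividing by \<open>s\<close> and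
  letting \<open>s\<close> tend to \<open>0\<close> shows that \<open>m\<^sub>1(G)\<close> and \<open>m\<^sub>2(G)\<close> have the same positive ratio as the potentials.
  For \<open>G = min(1, X\<^sub>0) 1{1 < T\<^sub>0 \<le> 2}\<close> this is absurd, because \<open>m\<^sub>2(G) = 0 < m\<^sub>1(G)\<close>.
\<close>

section \<open>Scale-invariant measures on the half-line\<close>

text \<open>
  The integrals over \<open>s\<close> are \<open>\<integral> y\<^bsup>p - 1\<^esup> f(y) dy\<close> over \<open>y > 0\<close>, written in the coordinate \<open>s = ln y\<close>, in
  which the inversion used by the Haar argument is \<open>s \<mapsto> -s\<close>.
\<close>

lemma nn_integral_scale_invariant:
  fixes Y :: "'a \<Rightarrow> real" and f q :: "real \<Rightarrow> ennreal" and p :: real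
  assumes M: "sigma_finite_measure M"
    and [measurable]: "Y \<in> borel_measurable M" "f \<in> borel_measurable borel" "q \<in> borel_measurable borel"
    and zero: "\<And>y. y \<le> 0 \<Longrightarrow> f y = 0" "\<And>y. y \<le> 0 \<Longrightarrow> q y = 0"
    and scale: "\<And>a h. 0 < a \<Longrightarrow> h \<in> borel_measurable borel \<Longrightarrow>
      (\<integral>\<^sup>+x. h (a * Y x) \<partial>M) = ennreal (a powr (- p)) * (\<integral>\<^sup>+x. h (Y x) \<partial>M)"
  shows "(\<integral>\<^sup>+x. q (Y x) \<partial>M) * (\<integral>\<^sup>+s. ennreal (exp (p * s)) * f (exp s) \<partial>lborel) =
         (\<integral>\<^sup>+x. f (Y x) \<partial>M) * (\<integral>\<^sup>+s. ennreal (exp (p * s)) * q (exp s) \<partial>lborel)"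
proof -
  interpret sigma_finite_measure M by fact
  interpret pair_sigma_finite M "lborel :: real measure" ..
  \<comment> \<open>Translation of s by ln y: the weight exp (p * s) gains the factor y powr p and
    the argument exp s the factor y.\<close>
  have L: "(\<integral>\<^sup>+s. ennreal (exp (p * s)) * g (exp s) \<partial>lborel) =
      ennreal (y powr p) * (\<integral>\<^sup>+s. ennreal (exp (p * s)) * g (exp s * y) \<partial>lborel)"
    if [measurable]: "g \<in> borel_measurable borel" and y: "0 < y" for g :: "real \<Rightarrow> ennreal" and y :: real
  proof -
    have "(\<integral>\<^sup>+s. ennreal (exp (p * s)) * g (exp s) \<partial>lborel) =
       (\<integral>\<^sup>+s. ennreal (exp (p * (ln y + 1 * s))) * g (exp (ln y + 1 * s)) \<partial>lborel)"
      by (subst nn_integral_real_affine[where c = 1 and t = "ln y"]) auto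
    also have "\<dots> = (\<integral>\<^sup>+s. ennreal (y powr p) * (ennreal (exp (p * s)) * g (exp s * y)) \<partial>lborel)"
    proof (rule nn_integral_cong)
      fix s :: real
      have "exp (p * (ln y + 1 * s)) = y powr p * exp (p * s)" "exp (ln y + 1 * s) = exp s * y"
        using y by (simp_all add: powr_def exp_add distrib_left)
      then show "ennreal (exp (p * (ln y + 1 * s))) * g (exp (ln y + 1 * s)) =
          ennreal (y powr p) * (ennreal (exp (p * s)) * g (exp s * y))"
        by (simp only: ennreal_mult powr_ge_zero exp_ge_zero mult.assoc)
    qed
    finally show ?thesis by (simp add: nn_integral_cmult)
  qed
  have "(\<integral>\<^sup>+x. q (Y x) \<partial>M) * (\<integral>\<^sup>+s. ennreal (exp (p * s)) * f (exp s) \<partial>lborel) =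
      (\<integral>\<^sup>+x. q (Y x) * (\<integral>\<^sup>+s. ennreal (exp (p * s)) * f (exp s) \<partial>lborel) \<partial>M)"
    by (simp add: nn_integral_multc)
  \<comment> \<open>Where Y x > 0, fact \<open>L\<close> with y = Y x brings Y x into the argument
    of f; elsewhere both sides vanish together with q.\<close>
  also have "\<dots> = (\<integral>\<^sup>+x. \<integral>\<^sup>+s. q (Y x) * (ennreal (Y x powr p) * (ennreal (exp (p * s)) * f (exp s * Y x))) \<partial>lborel \<partial>M)"
  proof (rule nn_integral_cong)
    fix x show "q (Y x) * (\<integral>\<^sup>+s. ennreal (exp (p * s)) * f (exp s) \<partial>lborel) =
      (\<integral>\<^sup>+s. q (Y x) * (ennreal (Y x powr p) * (ennreal (exp (p * s)) * f (exp s * Y x))) \<partial>lborel)"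
      by (cases "0 < Y x") (simp_all add: L[of f "Y x"] nn_integral_cmult zero)
  qed
  also have "\<dots> = (\<integral>\<^sup>+s. \<integral>\<^sup>+x. q (Y x) * (ennreal (Y x powr p) * (ennreal (exp (p * s)) * f (exp s * Y x))) \<partial>M \<partial>lborel)"
    by (rule Fubini'[symmetric]) measurable
  \<comment> \<open>For fixed s the integrand is exp (p * s) times \<open>?h\<close> at exp s * Y x.
    Invariance with a = exp s replaces that argument by Y x, and its factor exp (- p * s) cancels
    the weight. This exchanges the roles of f and q.\<close>
  also have "\<dots> = (\<integral>\<^sup>+s. \<integral>\<^sup>+x. f (Y x) * (ennreal (Y x powr p) * (ennreal (exp (p * - s)) * q (exp (- s) * Y x))) \<partial>M \<partial>lborel)"
  proof (rule nn_integral_cong)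
    fix s :: real
    let ?h = "\<lambda>y. q (exp (- s) * y) * (ennreal ((exp (- s) * y) powr p) * f y)"
    have "(\<integral>\<^sup>+x. q (Y x) * (ennreal (Y x powr p) * (ennreal (exp (p * s)) * f (exp s * Y x))) \<partial>M)
       = (\<integral>\<^sup>+x. ennreal (exp (p * s)) * ?h (exp s * Y x) \<partial>M)"
    proof (rule nn_integral_cong)
      fix x
      have "exp (- s) * (exp s * Y x) = Y x"
        by (simp add: exp_minus)
      then show "q (Y x) * (ennreal (Y x powr p) * (ennreal (exp (p * s)) * f (exp s * Y x))) =
          ennreal (exp (p * s)) * ?h (exp s * Y x)"
        by (simp only: ac_simps)
    qed
    also have "\<dots> = ennreal (exp (p * s)) * (ennreal (exp s powr (- p)) * (\<integral>\<^sup>+x. ?h (Y x) \<partial>M))"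
    proof -
      have "(\<integral>\<^sup>+x. ?h (exp s * Y x) \<partial>M) = ennreal (exp s powr (- p)) * (\<integral>\<^sup>+x. ?h (Y x) \<partial>M)"
        by (rule scale) auto
      moreover have m: "(\<lambda>x. ?h (exp s * Y x)) \<in> borel_measurable M"
        by measurable
      ultimately show ?thesis
        by (simp only: nn_integral_cmult[OF m])
    qed
    also have "\<dots> = (\<integral>\<^sup>+x. ?h (Y x) \<partial>M)"
      by (simp add: powr_def exp_minus flip: mult.assoc ennreal_mult)
    also have "\<dots> = (\<integral>\<^sup>+x. f (Y x) * (ennreal (Y x powr p) * (ennreal (exp (p * - s)) * q (exp (- s) * Y x))) \<partial>M)"
    proof (rule nn_integral_cong)
      fix x show "?h (Y x) = f (Y x) * (ennreal (Y x powr p) * (ennreal (exp (p * - s)) * q (exp (- s) * Y x)))"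
      proof (cases "0 < Y x")
        case True
        then have "ennreal ((exp (- s) * Y x) powr p) = ennreal (Y x powr p) * ennreal (exp (p * - s))"
          by (simp add: powr_mult powr_def[of "exp _"] flip: ennreal_mult)
        then show ?thesis by (simp add: ac_simps)
      qed (simp add: zero)
    qed
    finally show "(\<integral>\<^sup>+x. q (Y x) * (ennreal (Y x powr p) * (ennreal (exp (p * s)) * f (exp s * Y x))) \<partial>M) = \<dots>" .
  qed
  also have "\<dots> = (\<integral>\<^sup>+x. \<integral>\<^sup>+s. f (Y x) * (ennreal (Y x powr p) * (ennreal (exp (p * - s)) * q (exp (- s) * Y x))) \<partial>lborel \<partial>M)"
    by (rule Fubini') measurable
  also have "\<dots> = (\<integral>\<^sup>+x. f (Y x) * (\<integral>\<^sup>+s. ennreal (exp (p * s)) * q (exp s) \<partial>lborel) \<partial>M)"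
  proof (rule nn_integral_cong)
    fix x
    \<comment> \<open>Reflection s to -s, after which \<open>L\<close> for q removes Y x from the
      argument again.\<close>
    have "(\<integral>\<^sup>+s. ennreal (exp (p * - s)) * q (exp (- s) * Y x) \<partial>lborel) = (\<integral>\<^sup>+s. ennreal (exp (p * s)) * q (exp s * Y x) \<partial>lborel)"
      by (subst nn_integral_real_affine[where c = "-1" and t = 0]) auto
    then show "(\<integral>\<^sup>+s. f (Y x) * (ennreal (Y x powr p) * (ennreal (exp (p * - s)) * q (exp (- s) * Y x))) \<partial>lborel)
       = f (Y x) * (\<integral>\<^sup>+s. ennreal (exp (p * s)) * q (exp s) \<partial>lborel)"
      by (cases "0 < Y x") (simp_all add: L[of q "Y x"] nn_integral_cmult zero)
  qed
  finally show ?thesis by (simp add: nn_integral_multc)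
qed

section \<open>Lebesgue measure on the positive half-line\<close>

abbreviation pos_lborel :: "real measure" where
  "pos_lborel \<equiv> restrict_space lborel {0<..}"

lemma sigma_finite_pos_lborel: "sigma_finite_measure pos_lborel"
  by (rule sigma_finite_measure_restrict_space) (auto simp: sigma_finite_lborel)

lemma nn_integral_pos_lborel_scale:
  assumes "0 < c" and g: "g \<in> borel_measurable pos_lborel"
  shows "(\<integral>\<^sup>+t. g (c * t) \<partial>pos_lborel) = ennreal (1 / c) * (\<integral>\<^sup>+t. g t \<partial>pos_lborel)"
proof -
  have [measurable]: "(\<lambda>t. g t * indicator {0<..} t) \<in> borel_measurable borel"
    using g by (subst (asm) borel_measurable_restrict_space_iff_ennreal) auto
  have "(\<integral>\<^sup>+t. g t \<partial>pos_lborel) = (\<integral>\<^sup>+t. g t * indicator {0<..} t \<partial>lborel)"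
    by (simp add: nn_integral_restrict_space)
  also have "\<dots> = ennreal c * (\<integral>\<^sup>+t. g (c * t) * indicator {0<..} (c * t) \<partial>lborel)"
    using nn_integral_real_affine[of "\<lambda>t. g t * indicator {0<..} t" c 0] \<open>0 < c\<close> by simp
  also have "\<dots> = ennreal c * (\<integral>\<^sup>+t. g (c * t) \<partial>pos_lborel)"
    using \<open>0 < c\<close> by (simp add: nn_integral_restrict_space indicator_def zero_less_mult_iff)
  finally show ?thesis
    using \<open>0 < c\<close> by (simp flip: mult.assoc ennreal_mult)
qed

lemma measurable_snd_pos_lborel [measurable]: "snd \<in> borel_measurable (M \<Otimes>\<^sub>M pos_lborel)"
  by (rule measurable_compose[OF measurable_snd]) (simp add: measurable_restrict_space1)

lemma nn_integral_pos_lborel: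
  "(\<integral>\<^sup>+t. g t \<partial>pos_lborel) = (\<integral>\<^sup>+t. g t * indicator {0<..} t \<partial>lborel)"
  by (simp add: nn_integral_restrict_space)

text \<open>Split the integral at s, then rescale the part over ]0, s] to ]0, 1]. The domain of that
  part no longer depends on s, which prepares a dominated convergence argument as s tends to
  0.\<close>

lemma nn_integral_pos_lborel_split:
  assumes "0 < s" and g: "g \<in> borel_measurable pos_lborel"
  shows "(\<integral>\<^sup>+t. g t \<partial>pos_lborel) =
    ennreal s * (\<integral>\<^sup>+t. g (s * t) * indicator {..1} t \<partial>pos_lborel) + (\<integral>\<^sup>+t. g (s + t) \<partial>pos_lborel)"
proof -
  have g' [measurable]: "(\<lambda>t. g t * indicator {0<..} t) \<in> borel_measurable borel"
    using g by (subst (asm) borel_measurable_restrict_space_iff_ennreal) auto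
  have [measurable]: "(\<lambda>t. g t * indicator {..s} t) \<in> borel_measurable pos_lborel"
    using g by (intro borel_measurable_times_ennreal) (auto intro!: measurable_restrict_space1)
  have "(\<integral>\<^sup>+t. g t \<partial>pos_lborel) = (\<integral>\<^sup>+t. g t * indicator {0<..} t \<partial>lborel)"
    by (simp add: nn_integral_restrict_space)
  also have "\<dots> = (\<integral>\<^sup>+t. (g t * indicator {0<..} t) * indicator {..s} t + (g t * indicator {0<..} t) * indicator {s<..} t \<partial>lborel)"
    by (intro nn_integral_cong) (auto simp: indicator_def)
  also have "\<dots> = (\<integral>\<^sup>+t. (g t * indicator {0<..} t) * indicator {..s} t \<partial>lborel)
      + (\<integral>\<^sup>+t. (g t * indicator {0<..} t) * indicator {s<..} t \<partial>lborel)"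
    by (rule nn_integral_add) measurable
  also have "(\<integral>\<^sup>+t. (g t * indicator {0<..} t) * indicator {..s} t \<partial>lborel) = (\<integral>\<^sup>+t. g t * indicator {..s} t \<partial>pos_lborel)"
    by (simp add: nn_integral_restrict_space ac_simps)
  also have "\<dots> = ennreal s * (\<integral>\<^sup>+t. g (s * t) * indicator {..s} (s * t) \<partial>pos_lborel)"
    using \<open>0 < s\<close> by (subst nn_integral_pos_lborel_scale) (simp_all flip: mult.assoc ennreal_mult)
  also have "(\<integral>\<^sup>+t. g (s * t) * indicator {..s} (s * t) \<partial>pos_lborel) = (\<integral>\<^sup>+t. g (s * t) * indicator {..1} t \<partial>pos_lborel)"
    using \<open>0 < s\<close> by (intro nn_integral_cong) (auto simp: indicator_def)
  also have "(\<integral>\<^sup>+t. (g t * indicator {0<..} t) * indicator {s<..} t \<partial>lborel) =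
      (\<integral>\<^sup>+t. (g (s + t) * indicator {0<..} (s + t)) * indicator {s<..} (s + t) \<partial>lborel)"
    using nn_integral_real_affine[of "\<lambda>t. (g t * indicator {0<..} t) * indicator {s<..} t" 1 s] by simp
  also have "\<dots> = (\<integral>\<^sup>+t. g (s + t) \<partial>pos_lborel)"
    unfolding nn_integral_pos_lborel
    using \<open>0 < s\<close> by (intro nn_integral_cong) (auto simp: indicator_def)
  finally show ?thesis .
qed

section \<open>Joint measurability in path and time\<close>

text \<open>Right-continuity makes evaluation the pointwise limit of evaluations at times rounded up
  to a countable grid, and those are measurable piece by piece.\<close>

lemma measurable_coordinate_pair:
  "(\<lambda>z. fst z (snd z)) \<in> borel_measurable (\<G> \<infinity> \<Otimes>\<^sub>M restrict_space lborel {0<..})"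
    (is "_ \<in> borel_measurable ?M")
proof -
  \<comment> \<open>\<open>r k t\<close> is the first point strictly above t of the grid of mesh 1 /
    (k + 1). Strictness matters because \<open>at_right t\<close> excludes t.\<close>
  define r where "r k t = (real_of_int \<lfloor>real (Suc k) * t\<rfloor> + 1) / real (Suc k)" for k t
  have 1: "(\<lambda>k. fst z (r k (snd z))) \<longlonglongrightarrow> fst z (snd z)" if "z \<in> space ?M" for z
  proof -
    obtain \<omega> t where z: "z = (\<omega>, t)" by (cases z)
    have t: "0 < t" and \<omega>: "(\<omega> \<longlongrightarrow> \<omega> t) (at_right t)"
      using that by (auto simp: z space_pair_measure space_restrict_space cadlag_paths_def continuous_within)
    have gt: "t < r k t" for k
      unfolding r_def by (subst pos_less_divide_eq) (simp, subst mult.commute, linarith)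
    have le: "r k t \<le> t + inverse (real (Suc k))" for k
    proof -
      have "r k t \<le> (real (Suc k) * t + 1) / real (Suc k)"
        unfolding r_def by (intro divide_right_mono) auto
      also have "\<dots> = t + inverse (real (Suc k))"
        by (simp add: add_divide_distrib inverse_eq_divide)
      finally show ?thesis .
    qed
    have "(\<lambda>k. r k t) \<longlonglongrightarrow> t"
    proof (rule tendsto_sandwich[where f = "\<lambda>_. t"])
      show "(\<lambda>k. t + inverse (real (Suc k))) \<longlonglongrightarrow> t"
        using tendsto_add[OF tendsto_const LIMSEQ_inverse_real_of_nat, of t] by simp
    qed (intro always_eventually allI less_imp_le[OF gt] le tendsto_const)+
    then have "filterlim (\<lambda>k. r k t) (at_right t) sequentially"
      by (auto simp: filterlim_at gt less_imp_neq[OF gt, symmetric])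
    from filterlim_compose[OF \<omega> this] show ?thesis by (simp add: z)
  qed
  have 2: "(\<lambda>z. fst z (r k (snd z))) \<in> borel_measurable ?M" for k
  proof -
    \<comment> \<open>The index i runs through all integers, so \<open>max 0\<close> keeps the
      evaluation time where coordinates are measurable; at positive times it changes
      nothing.\<close>
    have c: "(\<lambda>z. fst z (max 0 ((real_of_int i + 1) / real (Suc k)))) \<in> borel_measurable ?M" for i
      by (rule measurable_compose[OF measurable_fst measurable_coordinate]) auto
    have [measurable]: "snd \<in> borel_measurable ?M"
      by (rule measurable_compose[OF measurable_snd]) (simp add: measurable_restrict_space1)
    have "(\<lambda>z. \<lfloor>real (Suc k) * snd z\<rfloor>) \<in> ?M \<rightarrow>\<^sub>M count_space UNIV"
      by measurable
    from measurable_compose_countable[OF c this]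
    have "(\<lambda>z. fst z (max 0 (r k (snd z)))) \<in> borel_measurable ?M"
      by (simp add: r_def)
    moreover have "max 0 (r k (snd z)) = r k (snd z)" if "z \<in> space ?M" for z
    proof -
      have "0 < snd z"
        using that by (auto simp: space_pair_measure space_restrict_space)
      then show ?thesis
        by (simp add: r_def max_def)
    qed
    ultimately show ?thesis
      by (subst measurable_cong[where g = "\<lambda>z. fst z (max 0 (r k (snd z)))"]) simp_all
  qed
  show ?thesis
    by (rule borel_measurable_LIMSEQ_real[OF 1 2])
qed

text \<open>The shifted path at time s is the original path at the positive time t + s, so joint
  measurability of the coordinates suffices.\<close>

lemma measurable_shift_path_pair:
  "(\<lambda>z. shift_path (snd z) (fst z)) \<in> \<G> \<infinity> \<Otimes>\<^sub>M pos_lborel \<rightarrow>\<^sub>M \<G> \<infinity>"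
proof (rule measurable_into_paths)
  show "(\<lambda>z. shift_path (snd z) (fst z)) \<in> space (\<G> \<infinity> \<Otimes>\<^sub>M pos_lborel) \<rightarrow> cadlag_paths"
  proof
    fix z :: "path \<times> real" assume "z \<in> space (\<G> \<infinity> \<Otimes>\<^sub>M pos_lborel)"
    then have "fst z \<in> cadlag_paths" "0 \<le> snd z"
      by (auto simp: space_pair_measure space_restrict_space)
    then show "shift_path (snd z) (fst z) \<in> cadlag_paths"
      using measurable_space[OF measurable_shift_path] by simp
  qed
  fix s :: real assume s: "0 \<le> s"
  have "(\<lambda>z. snd z + s) \<in> \<G> \<infinity> \<Otimes>\<^sub>M pos_lborel \<rightarrow>\<^sub>M pos_lborel"
    using s by (auto intro!: measurable_restrict_space2 simp: space_pair_measure space_restrict_space)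
  then have "(\<lambda>z. (fst z, snd z + s)) \<in> \<G> \<infinity> \<Otimes>\<^sub>M pos_lborel \<rightarrow>\<^sub>M \<G> \<infinity> \<Otimes>\<^sub>M pos_lborel"
    by (intro measurable_Pair measurable_fst)
  from measurable_compose[OF this measurable_coordinate_pair]
  show "(\<lambda>z. shift_path (snd z) (fst z) s) \<in> borel_measurable (\<G> \<infinity> \<Otimes>\<^sub>M pos_lborel)"
    using s by (simp add: shift_path_def)
qed

lemma shift_path_shift_path: "0 \<le> s \<Longrightarrow> shift_path s (shift_path t \<omega>) = shift_path (s + t) \<omega>"
  by (auto simp: shift_path_def fun_eq_iff ac_simps)

section \<open>The potential of a self-similar excursion measure\<close>

text \<open>The integral of H along the shifted excursion over t < T_0. The condition t < T_0 is
  encoded as X_t > 0, which is measurable and agrees with it on absorbed paths.\<close>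

definition occupation :: "path measure \<Rightarrow> (path \<Rightarrow> real) \<Rightarrow> ennreal" where
  "occupation m H = (\<integral>\<^sup>+z. indicator {0<..} (fst z (snd z)) * ennreal (H (shift_path (snd z) (fst z)))
     \<partial>(m \<Otimes>\<^sub>M pos_lborel))"

text \<open>The cut-off at y > 0 gives a function on the whole line although P is a kernel only on
  the closed half-line, and it provides the vanishing at y \<le> 0 required for the Haar
  argument.\<close>

definition expect_from :: "(real \<Rightarrow> path measure) \<Rightarrow> (path \<Rightarrow> real) \<Rightarrow> real \<Rightarrow> ennreal" where
  "expect_from P H y = indicator {0<..} y * (\<integral>\<^sup>+\<eta>. ennreal (H \<eta>) \<partial>P y)"

text \<open>In the coordinate y = exp s this is integration against y powr (p - 1) dy. For p = (1 -
  \<gamma>) / \<alpha> this measure scales like the potential.\<close>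

definition log_integral :: "real \<Rightarrow> (real \<Rightarrow> ennreal) \<Rightarrow> ennreal" where
  "log_integral p f = (\<integral>\<^sup>+s. ennreal (exp (p * s)) * f (exp s) \<partial>lborel)"

text \<open>These are consequences of being a self-similar excursion measure that pass to the
  restrictions to {X_0 > 0} and {X_0 = 0}. T_0 is eliminated in favour of coordinates, and all
  integrals are nonnegative ones, so that no integrability has to be carried along.\<close>

locale selfsimilar_excursions = sigma_finite_measure m
  for m :: "path measure" and P :: "real \<Rightarrow> path measure" and \<alpha> \<gamma> :: real +
  assumes sets_m [measurable_cong]: "sets m = sets (\<G> \<infinity>)"
    and \<alpha>_pos: "0 < \<alpha>" and \<gamma>_pos: "0 < \<gamma>"
    and kernel: "P \<in> restrict_space borel {0..} \<rightarrow>\<^sub>M prob_algebra (\<G> \<infinity>)"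
    and alive: "AE \<omega> in m. \<exists>t>0. 0 < \<omega> t"
    and absorbed: "AE \<omega> in m. \<forall>s t. 0 < s \<longrightarrow> s \<le> t \<longrightarrow> \<omega> s = 0 \<longrightarrow> \<omega> t = 0"
    and alive_finite: "0 < t \<Longrightarrow> emeasure m {\<omega> \<in> space m. 0 < \<omega> t} < \<infinity>"
    and markov: "H \<in> borel_measurable (\<G> \<infinity>) \<Longrightarrow> (\<And>\<omega>. 0 \<le> H \<omega> \<and> H \<omega> \<le> 1) \<Longrightarrow> 0 < t \<Longrightarrow>
      (\<integral>\<^sup>+\<omega>. indicator {0<..} (\<omega> t) * ennreal (H (shift_path t \<omega>)) \<partial>m) =
      (\<integral>\<^sup>+\<omega>. indicator {0<..} (\<omega> t) * (\<integral>\<^sup>+\<eta>. ennreal (H \<eta>) \<partial>P (\<omega> t)) \<partial>m)"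
    and selfsimilar: "0 < a \<Longrightarrow> F \<in> borel_measurable (\<G> \<infinity>) \<Longrightarrow>
      (\<integral>\<^sup>+\<omega>. F (scale_path \<alpha> a \<omega>) \<partial>m) = ennreal (a powr (\<gamma> / \<alpha>)) * (\<integral>\<^sup>+\<omega>. F \<omega> \<partial>m)"
begin

sublocale time: pair_sigma_finite m pos_lborel
  by (intro pair_sigma_finite.intro sigma_finite_measure_axioms sigma_finite_pos_lborel)

lemma space_m: "space m = cadlag_paths"
  using sets_eq_imp_space_eq[OF sets_m] by simp

lemma measurable_at [measurable (raw)]: "0 \<le> t \<Longrightarrow> (\<lambda>\<omega>. \<omega> t) \<in> borel_measurable m"
  using measurable_coordinate[of t \<infinity>] by (simp add: measurable_cong_sets[OF sets_m refl])

lemma measurable_at_pair [measurable]: "(\<lambda>z. fst z (snd z)) \<in> borel_measurable (m \<Otimes>\<^sub>M pos_lborel)"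
  using measurable_coordinate_pair
  by (simp cong: measurable_cong_sets add: measurable_cong_sets[OF sets_pair_measure_cong[OF sets_m refl] refl])

lemma measurable_shift_pair [measurable]:
  "(\<lambda>z. shift_path (snd z) (fst z)) \<in> m \<Otimes>\<^sub>M pos_lborel \<rightarrow>\<^sub>M \<G> \<infinity>"
  using measurable_shift_path_pair
  by (simp cong: measurable_cong_sets add: measurable_cong_sets[OF sets_pair_measure_cong[OF sets_m refl] refl])

lemma measurable_expect_from [measurable]:
  assumes H: "H \<in> borel_measurable (\<G> \<infinity>)"
  shows "expect_from P H \<in> borel_measurable borel"
proof -
  have "(\<lambda>y. \<integral>\<^sup>+\<eta>. ennreal (H \<eta>) \<partial>P y) \<in> borel_measurable (restrict_space borel {0..})"
    by (rule measurable_compose[OF measurable_prob_algebraD[OF kernel] nn_integral_measurable_subprob_algebra])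
       (use H in measurable)
  then have "(\<lambda>y. (\<integral>\<^sup>+\<eta>. ennreal (H \<eta>) \<partial>P y) * indicator {0..} y) \<in> borel_measurable borel"
    by (subst (asm) borel_measurable_restrict_space_iff_ennreal) auto
  then have "(\<lambda>y. indicator {0<..} y * ((\<integral>\<^sup>+\<eta>. ennreal (H \<eta>) \<partial>P y) * indicator {0..} y)) \<in> borel_measurable borel"
    by measurable
  moreover have "(\<lambda>y. indicator {0<..} y * ((\<integral>\<^sup>+\<eta>. ennreal (H \<eta>) \<partial>P y) * indicator {0..} y)) = expect_from P H"
    by (auto simp: expect_from_def indicator_def fun_eq_iff)
  ultimately show ?thesis by simp
qed

text \<open>Fubini and the Markov property at each fixed t > 0. The right-hand side sees m only
  through its potential.\<close>

lemma occupation_eq_expect_from: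
  assumes [measurable]: "H \<in> borel_measurable (\<G> \<infinity>)" and H: "\<And>\<omega>. 0 \<le> H \<omega> \<and> H \<omega> \<le> 1"
  shows "occupation m H = (\<integral>\<^sup>+z. expect_from P H (fst z (snd z)) \<partial>(m \<Otimes>\<^sub>M pos_lborel))"
proof -
  have "occupation m H = (\<integral>\<^sup>+t. \<integral>\<^sup>+\<omega>. indicator {0<..} (\<omega> t) * ennreal (H (shift_path t \<omega>)) \<partial>m \<partial>pos_lborel)"
    unfolding occupation_def by (subst time.nn_integral_snd[symmetric]) (simp_all add: split_beta')
  also have "\<dots> = (\<integral>\<^sup>+t. \<integral>\<^sup>+\<omega>. expect_from P H (\<omega> t) \<partial>m \<partial>pos_lborel)"
    by (rule nn_integral_cong) (simp add: expect_from_def space_restrict_space markov[OF assms])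
  also have "\<dots> = (\<integral>\<^sup>+z. expect_from P H (fst z (snd z)) \<partial>(m \<Otimes>\<^sub>M pos_lborel))"
    by (subst time.nn_integral_snd[symmetric]) (simp_all add: split_beta')
  finally show ?thesis .
qed

text \<open>Apply self-similarity to the time integral of h along a path. The change of time
  contributes a powr (1 / \<alpha>) on one side and self-similarity a powr (\<gamma> / \<alpha>) on
  the other; their quotient is the factor claimed.\<close>

lemma occupation_scale:
  assumes "0 < a" and [measurable]: "h \<in> borel_measurable borel"
  shows "(\<integral>\<^sup>+z. h (a * fst z (snd z)) \<partial>(m \<Otimes>\<^sub>M pos_lborel)) =
    ennreal (a powr (- ((1 - \<gamma>) / \<alpha>))) * (\<integral>\<^sup>+z. h (fst z (snd z)) \<partial>(m \<Otimes>\<^sub>M pos_lborel))"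
proof -
  let ?b = "a powr (- 1 / \<alpha>)"
  define F where "F \<omega> = (\<integral>\<^sup>+t. h (\<omega> t) \<partial>pos_lborel)" for \<omega> :: path
  have F_meas: "F \<in> borel_measurable (\<G> \<infinity>)"
  proof -
    have "(\<lambda>z. h (fst z (snd z))) \<in> borel_measurable (\<G> \<infinity> \<Otimes>\<^sub>M pos_lborel)"
      using measurable_coordinate_pair by measurable
    from time.M2.borel_measurable_nn_integral_fst[OF this] show ?thesis
      by (simp add: F_def[abs_def] top_ennreal_def)
  qed
  have at: "(\<lambda>t. \<omega> t) \<in> borel_measurable pos_lborel" if "\<omega> \<in> space m" for \<omega>
    using measurable_compose[OF measurable_Pair1'[OF that] measurable_at_pair] by simp
  have "F (scale_path \<alpha> a \<omega>) = ennreal (a powr (1 / \<alpha>)) * (\<integral>\<^sup>+t. h (a * \<omega> t) \<partial>pos_lborel)"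
    if "\<omega> \<in> space m" for \<omega>
  proof -
    have [measurable]: "\<omega> \<in> borel_measurable pos_lborel" using at[OF that] .
    have "F (scale_path \<alpha> a \<omega>) = (\<integral>\<^sup>+t. h (a * \<omega> (?b * t)) \<partial>pos_lborel)"
      unfolding F_def by (intro nn_integral_cong) (simp add: scale_path_def space_restrict_space)
    also have "\<dots> = ennreal (1 / ?b) * (\<integral>\<^sup>+t. h (a * \<omega> t) \<partial>pos_lborel)"
      by (rule nn_integral_pos_lborel_scale) (use \<open>0 < a\<close> in auto)
    finally show ?thesis
      by (simp add: powr_minus divide_inverse)
  qed
  then have "(\<integral>\<^sup>+\<omega>. F (scale_path \<alpha> a \<omega>) \<partial>m) =
      (\<integral>\<^sup>+\<omega>. ennreal (a powr (1 / \<alpha>)) * (\<integral>\<^sup>+t. h (a * \<omega> t) \<partial>pos_lborel) \<partial>m)"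
    by (rule nn_integral_cong)
  also have "\<dots> = ennreal (a powr (1 / \<alpha>)) * (\<integral>\<^sup>+\<omega>. (\<integral>\<^sup>+t. h (a * \<omega> t) \<partial>pos_lborel) \<partial>m)"
    by (rule nn_integral_cmult)
       (use time.M2.borel_measurable_nn_integral_fst[of "\<lambda>z. h (a * fst z (snd z))" m] in simp)
  also have "(\<integral>\<^sup>+\<omega>. (\<integral>\<^sup>+t. h (a * \<omega> t) \<partial>pos_lborel) \<partial>m) = (\<integral>\<^sup>+z. h (a * fst z (snd z)) \<partial>(m \<Otimes>\<^sub>M pos_lborel))"
    by (subst time.M2.nn_integral_fst[symmetric]) simp_all
  finally have "ennreal (a powr (1 / \<alpha>)) * (\<integral>\<^sup>+z. h (a * fst z (snd z)) \<partial>(m \<Otimes>\<^sub>M pos_lborel)) =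
      ennreal (a powr (\<gamma> / \<alpha>)) * (\<integral>\<^sup>+\<omega>. F \<omega> \<partial>m)"
    by (simp add: selfsimilar[OF \<open>0 < a\<close> F_meas])
  also have "(\<integral>\<^sup>+\<omega>. F \<omega> \<partial>m) = (\<integral>\<^sup>+z. h (fst z (snd z)) \<partial>(m \<Otimes>\<^sub>M pos_lborel))"
    unfolding F_def by (subst time.M2.nn_integral_fst[symmetric]) simp_all
  finally have "ennreal (a powr (- 1 / \<alpha>)) * (ennreal (a powr (1 / \<alpha>)) * (\<integral>\<^sup>+z. h (a * fst z (snd z)) \<partial>(m \<Otimes>\<^sub>M pos_lborel))) =
      ennreal (a powr (- 1 / \<alpha>)) * (ennreal (a powr (\<gamma> / \<alpha>)) * (\<integral>\<^sup>+z. h (fst z (snd z)) \<partial>(m \<Otimes>\<^sub>M pos_lborel)))"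
    by simp
  then show ?thesis
    using \<open>0 < a\<close> by (simp add: diff_divide_distrib flip: mult.assoc ennreal_mult powr_add)
qed

lemma expect_from_nonpos: "y \<le> 0 \<Longrightarrow> expect_from P H y = 0"
  by (simp add: expect_from_def)

text \<open>The Haar argument for (\<omega>, t) \<mapsto> \<omega> t on the product of m with
  Lebesgue measure. The cross-multiplied form avoids division in [0, \<infinity>] as long as the
  factors may be 0 or infinite.\<close>

lemma occupation_log_integral:
  assumes [measurable]: "H \<in> borel_measurable (\<G> \<infinity>)" "f \<in> borel_measurable borel"
    and H: "\<And>\<omega>. 0 \<le> H \<omega> \<and> H \<omega> \<le> 1" and f: "\<And>y. y \<le> 0 \<Longrightarrow> f y = 0"
  shows "occupation m H * log_integral ((1 - \<gamma>) / \<alpha>) f =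
    (\<integral>\<^sup>+z. f (fst z (snd z)) \<partial>(m \<Otimes>\<^sub>M pos_lborel)) * log_integral ((1 - \<gamma>) / \<alpha>) (expect_from P H)"
  unfolding occupation_eq_expect_from[OF assms(1,3)] log_integral_def
  by (rule nn_integral_scale_invariant)
     (use f in \<open>auto intro!: sigma_finite_pair_measure sigma_finite_measure_axioms
        sigma_finite_pos_lborel occupation_scale measurable_expect_from simp: expect_from_nonpos\<close>)

end

section \<open>A test functional\<close>

text \<open>
  For excursions \<open>dying\<close> is the indicator of \<open>1 < T\<^sub>0 \<le> 2\<close>.  The upper bound on \<open>T\<^sub>0\<close> makes its
  potential finite: \<open>{t. 1 < T\<^sub>0 - t \<le> 2}\<close> has bounded length.
\<close>

definition dying :: "path \<Rightarrow> real" where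
  "dying \<omega> = of_bool (0 < \<omega> 1 \<and> \<omega> 2 = 0)"

text \<open>This is the functional G of the overview. Its factor is continuous in X_0, unlike the
  indicator of X_0 > 0, so that G of the path shifted by t tends to G as t decreases to 0 even for
  excursions that start at 0. The \<open>max 0\<close> makes the bounds hold for all functions, not
  only for paths.\<close>

definition start_dying :: "path \<Rightarrow> real" where
  "start_dying \<omega> = min 1 (max 0 (\<omega> 0)) * dying \<omega>"

lemma measurable_dying [measurable]: "dying \<in> borel_measurable (\<G> \<infinity>)"
proof -
  have [measurable]: "(\<lambda>\<omega>. \<omega> 1) \<in> borel_measurable (\<G> \<infinity>)" "(\<lambda>\<omega>. \<omega> 2) \<in> borel_measurable (\<G> \<infinity>)"
    by (auto intro: measurable_coordinate)
  show ?thesis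
    unfolding dying_def[abs_def] by measurable
qed

lemma measurable_start_dying [measurable]: "start_dying \<in> borel_measurable (\<G> \<infinity>)"
proof -
  have [measurable]: "(\<lambda>\<omega>. \<omega> 0) \<in> borel_measurable (\<G> \<infinity>)"
    by (auto intro: measurable_coordinate)
  show ?thesis
    unfolding start_dying_def[abs_def] by measurable
qed

lemma dying_bounds: "0 \<le> dying \<omega> \<and> dying \<omega> \<le> 1"
  by (simp add: dying_def)

lemma start_dying_bounds: "0 \<le> start_dying \<omega> \<and> start_dying \<omega> \<le> 1"
  by (auto simp: start_dying_def dying_def)

lemma start_dying_le_dying: "start_dying \<omega> \<le> dying \<omega>"
  by (auto simp: start_dying_def dying_def)

section \<open>The law of the lifetime\<close>

context selfsimilar_excursions
begin

lemma alive_mono: "AE \<omega> in m. \<forall>s t. 0 < s \<longrightarrow> s \<le> t \<longrightarrow> 0 < \<omega> t \<longrightarrow> 0 < \<omega> s"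
  using absorbed AE_space
proof eventually_elim
  case (elim \<omega>)
  then have nonneg: "\<forall>t\<ge>0. 0 \<le> \<omega> t"
    by (simp add: space_m cadlag_paths_def)
  show ?case
  proof safe
    fix s t :: real assume "0 < s" "s \<le> t" "0 < \<omega> t"
    then show "0 < \<omega> s"
      using elim(1)[rule_format, of s t] nonneg[rule_format, of s] by fastforce
  qed
qed

text \<open>The scaling factor (t / s) powr \<alpha> is the one that carries time s to time t. The
  mass of {T_0 > s} is thus a multiple of s powr (- \<gamma>).\<close>

lemma alive_scale:
  assumes "0 < s" "0 < t"
  shows "emeasure m {\<omega> \<in> space m. 0 < \<omega> s} = ennreal ((t / s) powr \<gamma>) * emeasure m {\<omega> \<in> space m. 0 < \<omega> t}"
proof -
  let ?F = "\<lambda>\<omega>. indicator {0<..} (\<omega> t) :: ennreal" and ?a = "(t / s) powr \<alpha>"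
  have a: "0 < ?a" using assms by simp
  have F: "?F \<in> borel_measurable (\<G> \<infinity>)"
    by (rule measurable_compose[OF measurable_coordinate]) (use assms in auto)
  have eq: "(\<integral>\<^sup>+\<omega>. indicator {0<..} (\<omega> r) \<partial>m) = emeasure m {\<omega> \<in> space m. 0 < \<omega> r}" if "0 < r" for r
  proof -
    have "(\<integral>\<^sup>+\<omega>. indicator {0<..} (\<omega> r) \<partial>m) = (\<integral>\<^sup>+\<omega>. indicator {\<omega> \<in> space m. 0 < \<omega> r} \<omega> \<partial>m)"
      by (intro nn_integral_cong) (simp add: indicator_def)
    then show ?thesis using that by simp
  qed
  have "?a powr (- 1 / \<alpha>) * t = s"
    using assms \<alpha>_pos by (simp add: powr_powr powr_minus divide_simps)
  then have "?F (scale_path \<alpha> ?a \<omega>) = indicator {0<..} (\<omega> s)" for \<omega>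
    using assms a by (simp add: scale_path_def indicator_def zero_less_mult_iff)
  then have "(\<integral>\<^sup>+\<omega>. indicator {0<..} (\<omega> s) \<partial>m) = ennreal (?a powr (\<gamma> / \<alpha>)) * (\<integral>\<^sup>+\<omega>. ?F \<omega> \<partial>m)"
    using selfsimilar[OF a F] by simp
  moreover have "?a powr (\<gamma> / \<alpha>) = (t / s) powr \<gamma>"
    using \<alpha>_pos by (simp add: powr_powr)
  ultimately show ?thesis
    using assms by (simp add: eq)
qed

text \<open>If the mass vanishes at one time, scaling makes it vanish at all times 1 / (k + 1).
  Almost every path is then dead at arbitrarily small times, hence never alive, which leaves only
  the zero measure.\<close>

lemma alive_pos:
  assumes "emeasure m (space m) \<noteq> 0" "0 < t"
  shows "0 < emeasure m {\<omega> \<in> space m. 0 < \<omega> t}"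
proof (rule ccontr)
  assume "\<not> ?thesis"
  then have "emeasure m {\<omega> \<in> space m. 0 < \<omega> (inverse (real (Suc k)))} = 0" for k
    using alive_scale[of "inverse (real (Suc k))" t] \<open>0 < t\<close> by simp
  then have "AE \<omega> in m. \<not> 0 < \<omega> (inverse (real (Suc k)))" for k
    by (subst AE_iff_measurable[OF _ refl]) (auto simp: less_imp_le)
  then have "AE \<omega> in m. \<forall>k. \<not> 0 < \<omega> (inverse (real (Suc k)))"
    by (simp add: AE_all_countable)
  then have "AE \<omega> in m. False"
    using alive alive_mono
  proof eventually_elim
    case (elim \<omega>)
    then obtain r where r: "0 < r" "0 < \<omega> r" by blast
    obtain k where "inverse (real (Suc k)) < r"
      using reals_Archimedean[OF r(1)] by blast
    then show False
      using elim(1,3) r by (metis inverse_positive_iff_positive less_imp_le of_nat_0_less_iff zero_less_Suc)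
  qed
  then show False
    using assms(1) by (simp add: AE_iff_null null_sets_def)
qed

text \<open>The mass of {T_0 > r} is finite, positive and, since \<gamma> > 0, strictly decreasing
  in r. It therefore loses mass between s and t.\<close>

lemma dying_between_pos:
  assumes m: "emeasure m (space m) \<noteq> 0" and st: "0 < s" "s < t"
  shows "0 < emeasure m {\<omega> \<in> space m. 0 < \<omega> s \<and> \<omega> t = 0}"
proof (rule ccontr)
  let ?e = "\<lambda>r. emeasure m {\<omega> \<in> space m. 0 < \<omega> r}"
  assume "\<not> ?thesis"
  then have "AE \<omega> in m. \<not> (0 < \<omega> s \<and> \<omega> t = 0)"
    using st by (subst AE_iff_measurable[OF _ refl]) auto
  then have "AE \<omega> in m. 0 < \<omega> s \<longrightarrow> 0 < \<omega> t"
    using AE_space by eventually_elim (use st in \<open>auto simp: space_m cadlag_paths_def less_le\<close>)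
  then have "?e s \<le> ?e t"
    using st by (intro emeasure_mono_AE) auto
  moreover have "?e s = ennreal ((t / s) powr \<gamma>) * ?e t"
    using st by (intro alive_scale) auto
  moreover obtain c where c: "?e t = ennreal c" "0 < c"
    using alive_pos[OF m, of t] alive_finite[of t] st by (cases "?e t") auto
  moreover have "1 < (t / s) powr \<gamma>"
    using st \<gamma>_pos by (simp add: gr_one_powr)
  ultimately show False
    by (simp add: ennreal_mult[symmetric])
qed

section \<open>Finiteness and positivity of the potential of \<open>dying\<close>\<close>

lemma occupation_iterated:
  assumes [measurable]: "H \<in> borel_measurable (\<G> \<infinity>)"
  shows "occupation m H =
    (\<integral>\<^sup>+\<omega>. \<integral>\<^sup>+t. indicator {0<..} (\<omega> t) * ennreal (H (shift_path t \<omega>)) \<partial>pos_lborel \<partial>m)"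
  unfolding occupation_def by (subst time.M2.nn_integral_fst[symmetric]) simp_all

text \<open>For a single path the times t with 1 < T_0 - t \<le> 2 fill a set of length at most 2,
  which is empty unless the path is alive at time 1. The set {X_1 > 0} has finite mass.\<close>

lemma occupation_dying_finite: "occupation m dying < \<infinity>"
proof -
  have "occupation m dying \<le> (\<integral>\<^sup>+\<omega>. 2 * indicator {\<omega> \<in> space m. 0 < \<omega> 1} \<omega> \<partial>m)"
    unfolding occupation_iterated[OF measurable_dying]
  proof (rule nn_integral_mono_AE)
    show "AE \<omega> in m. (\<integral>\<^sup>+t. indicator {0<..} (\<omega> t) * ennreal (dying (shift_path t \<omega>)) \<partial>pos_lborel)
        \<le> 2 * indicator {\<omega> \<in> space m. 0 < \<omega> 1} \<omega>"
      using alive_mono AE_space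
    proof eventually_elim
      case (elim \<omega>)
      let ?S = "{t. 0 < t \<and> 0 < \<omega> (t + 1) \<and> \<omega> (t + 2) = 0}"
      have le: "(\<integral>\<^sup>+t. indicator {0<..} (\<omega> t) * ennreal (dying (shift_path t \<omega>)) \<partial>pos_lborel)
          \<le> (\<integral>\<^sup>+t. indicator T t \<partial>lborel)" if "?S \<subseteq> T" for T
        unfolding nn_integral_pos_lborel
        using that by (intro nn_integral_mono) (auto simp: dying_def shift_path_def indicator_def)
      show ?case
      proof (cases "?S = {}")
        case True
        then show ?thesis using le[of "{}"] by simp
      next
        case False
        then obtain r where r: "0 < r" "0 < \<omega> (r + 1)" "\<omega> (r + 2) = 0" by blast
        \<comment> \<open>Two elements r and t of \<open>?S\<close> differ by less than 1: otherwise
          the path would be alive at a time after it was already 0.\<close>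
        have "?S \<subseteq> {r - 1..r + 1}"
        proof
          fix t assume t: "t \<in> ?S"
          have "\<not> t + 2 \<le> r + 1" "\<not> r + 2 \<le> t + 1"
            using elim(1)[rule_format, of "t + 2" "r + 1"] elim(1)[rule_format, of "r + 2" "t + 1"] r t by auto
          then show "t \<in> {r - 1..r + 1}" by auto
        qed
        from le[OF this] have "(\<integral>\<^sup>+t. indicator {0<..} (\<omega> t) * ennreal (dying (shift_path t \<omega>)) \<partial>pos_lborel) \<le> 2"
          by simp
        moreover have "0 < \<omega> 1"
          using elim(1)[rule_format, of 1 "r + 1"] r by simp
        ultimately show ?thesis
          using elim(2) by simp
      qed
    qed
  qed
  also have "\<dots> = 2 * emeasure m {\<omega> \<in> space m. 0 < \<omega> 1}"
    by (rule nn_integral_cmult_indicator) simp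
  also have "\<dots> < \<infinity>"
    using alive_finite[of 1] by (simp add: ennreal_mult_less_top)
  finally show ?thesis .
qed

text \<open>At every t > 0 the inner integral is at least the mass of {t + 1 < T_0 \<le> t + 2},
  which is positive. A positive function of time cannot integrate to 0.\<close>

lemma occupation_dying_pos:
  assumes m: "emeasure m (space m) \<noteq> 0"
  shows "0 < occupation m dying"
proof (rule ccontr)
  let ?\<phi> = "\<lambda>t. \<integral>\<^sup>+\<omega>. indicator {0<..} (\<omega> t) * ennreal (dying (shift_path t \<omega>)) \<partial>m"
  assume "\<not> ?thesis"
  moreover have "occupation m dying = (\<integral>\<^sup>+t. ?\<phi> t \<partial>pos_lborel)"
    unfolding occupation_def by (subst time.nn_integral_snd[symmetric]) (simp_all add: split_beta')
  moreover have "?\<phi> \<in> borel_measurable pos_lborel"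
  proof -
    have "(\<lambda>z. indicator {0<..} (fst z (snd z)) * ennreal (dying (shift_path (snd z) (fst z)))) \<in>
        borel_measurable (m \<Otimes>\<^sub>M pos_lborel)"
      by measurable
    from borel_measurable_nn_integral_fst[OF measurable_pair_swap[OF this]] show ?thesis
      by simp
  qed
  ultimately have "AE t in pos_lborel. ?\<phi> t = 0"
    by (simp add: nn_integral_0_iff_AE)
  moreover have "?\<phi> t \<noteq> 0" if "0 < t" for t
  proof -
    have "0 < emeasure m {\<omega> \<in> space m. 0 < \<omega> (t + 1) \<and> \<omega> (t + 2) = 0}"
      using that by (intro dying_between_pos m) auto
    also have "\<dots> = (\<integral>\<^sup>+\<omega>. indicator {\<omega> \<in> space m. 0 < \<omega> (t + 1) \<and> \<omega> (t + 2) = 0} \<omega> \<partial>m)"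
      using that by simp
    also have "\<dots> \<le> ?\<phi> t"
    proof (rule nn_integral_mono_AE)
      show "AE \<omega> in m. indicator {\<omega> \<in> space m. 0 < \<omega> (t + 1) \<and> \<omega> (t + 2) = 0} \<omega> \<le>
          indicator {0<..} (\<omega> t) * ennreal (dying (shift_path t \<omega>))"
        using alive_mono
      proof eventually_elim
        case (elim \<omega>)
        then show ?case
          using elim[rule_format, of t "t + 1"] that
          by (auto simp: indicator_def dying_def shift_path_def)
      qed
    qed
    finally show ?thesis by simp
  qed
  ultimately have "AE t in pos_lborel. False"
    by (auto simp: AE_restrict_space_iff elim!: eventually_mono)
  then have "emeasure pos_lborel (space pos_lborel) = 0"
    by (subst (asm) AE_iff_measurable[OF sets.top]) auto
  moreover have "emeasure lborel {0<..<1::real} \<le> emeasure lborel {0::real<..}"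
    by (rule emeasure_mono) auto
  ultimately show False
    by (simp add: space_restrict_space emeasure_restrict_space)
qed

text \<open>The average over u in ]0, s] of m(G \<circ> s_u) with G = \<open>start_dying\<close>,
  written with u = s * t on the unit interval. The condition of being alive at u is implicit: for
  absorbed paths, a nonzero value of G after the shift forces it.\<close>

definition initial_mean :: "real \<Rightarrow> ennreal" where
  "initial_mean s = (\<integral>\<^sup>+z. ennreal (start_dying (shift_path (s * snd z) (fst z))) * indicator {..1} (snd z)
     \<partial>(m \<Otimes>\<^sub>M pos_lborel))"

lemma measurable_shift_scaled [measurable]:
  assumes "0 < s"
  shows "(\<lambda>z. shift_path (s * snd z) (fst z)) \<in> m \<Otimes>\<^sub>M pos_lborel \<rightarrow>\<^sub>M \<G> \<infinity>"
proof -
  have "(\<lambda>z. s * snd z) \<in> m \<Otimes>\<^sub>M pos_lborel \<rightarrow>\<^sub>M pos_lborel"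
    using assms by (auto intro!: measurable_restrict_space2 simp: space_pair_measure space_restrict_space)
  then have "(\<lambda>z. (fst z, s * snd z)) \<in> m \<Otimes>\<^sub>M pos_lborel \<rightarrow>\<^sub>M m \<Otimes>\<^sub>M pos_lborel"
    by (intro measurable_Pair measurable_fst)
  from measurable_compose[OF this measurable_shift_pair] show ?thesis
    by simp
qed

text \<open>Splitting the time integral at s, the part beyond s is the potential of the shifted
  functional and the part before s is s times the initial average.\<close>

lemma occupation_start_dying_split:
  assumes s: "0 < s"
  shows "occupation m start_dying =
    ennreal s * initial_mean s + occupation m (\<lambda>\<omega>. start_dying (shift_path s \<omega>))"
proof -
  have [measurable]: "shift_path s \<in> \<G> \<infinity> \<rightarrow>\<^sub>M \<G> \<infinity>"
    using s by (intro measurable_shift_path) simp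
  let ?g = "\<lambda>\<omega> t. ennreal (start_dying (shift_path t \<omega>))"
  \<comment> \<open>If G is nonzero after a shift by r, the path is alive at r + 1 and so at every
    earlier positive time. This reconciles the two potentials, whose indicators refer to the times t
    and s + t.\<close>
  have alive_shift: "AE \<omega> in m. \<forall>r t. 0 < t \<longrightarrow> t \<le> r \<longrightarrow> indicator {0<..} (\<omega> t) * ?g \<omega> r = ?g \<omega> r"
    using alive_mono
  proof eventually_elim
    case (elim \<omega>)
    show ?case
    proof safe
      fix r t :: real assume "0 < t" "t \<le> r"
      then show "indicator {0<..} (\<omega> t) * ?g \<omega> r = ?g \<omega> r"
        using elim[rule_format, of t "r + 1"]
        by (auto simp: indicator_def start_dying_def dying_def shift_path_def)
    qed
  qed
  have 1: "occupation m start_dying = (\<integral>\<^sup>+\<omega>. \<integral>\<^sup>+t. ?g \<omega> t \<partial>pos_lborel \<partial>m)"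
    unfolding occupation_iterated[OF measurable_start_dying]
    by (rule nn_integral_cong_AE, use alive_shift in eventually_elim)
       (auto intro!: nn_integral_cong simp: space_restrict_space)
  have 2: "occupation m (\<lambda>\<omega>. start_dying (shift_path s \<omega>)) = (\<integral>\<^sup>+\<omega>. \<integral>\<^sup>+t. ?g \<omega> (s + t) \<partial>pos_lborel \<partial>m)"
    by (subst occupation_iterated, measurable, rule nn_integral_cong_AE, use alive_shift in eventually_elim)
       (use s in \<open>auto intro!: nn_integral_cong simp: space_restrict_space shift_path_shift_path\<close>)
  have 3: "initial_mean s = (\<integral>\<^sup>+\<omega>. \<integral>\<^sup>+t. ?g \<omega> (s * t) * indicator {..1} t \<partial>pos_lborel \<partial>m)"
    unfolding initial_mean_def using s by (subst time.M2.nn_integral_fst[symmetric]) simp_all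
  have meas3: "(\<lambda>\<omega>. \<integral>\<^sup>+t. ?g \<omega> (s * t) * indicator {..1} t \<partial>pos_lborel) \<in> borel_measurable m"
    using time.M2.borel_measurable_nn_integral_fst[of "\<lambda>z. ?g (fst z) (s * snd z) * indicator {..1} (snd z)" m] s by simp
  have pair2: "(\<lambda>z. ?g (fst z) (s + snd z)) \<in> borel_measurable (m \<Otimes>\<^sub>M pos_lborel)"
  proof -
    have "(\<lambda>z. ennreal (start_dying (shift_path s (shift_path (snd z) (fst z))))) \<in> borel_measurable (m \<Otimes>\<^sub>M pos_lborel)"
      by measurable
    then show ?thesis using s by (simp add: shift_path_shift_path)
  qed
  have meas2: "(\<lambda>\<omega>. \<integral>\<^sup>+t. ?g \<omega> (s + t) \<partial>pos_lborel) \<in> borel_measurable m"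
    using time.M2.borel_measurable_nn_integral_fst[OF pair2] by simp
  have "(\<integral>\<^sup>+\<omega>. \<integral>\<^sup>+t. ?g \<omega> t \<partial>pos_lborel \<partial>m) =
      (\<integral>\<^sup>+\<omega>. ennreal s * (\<integral>\<^sup>+t. ?g \<omega> (s * t) * indicator {..1} t \<partial>pos_lborel) + (\<integral>\<^sup>+t. ?g \<omega> (s + t) \<partial>pos_lborel) \<partial>m)"
  proof (rule nn_integral_cong)
    fix \<omega> assume "\<omega> \<in> space m"
    then have "(\<lambda>t. shift_path t \<omega>) \<in> pos_lborel \<rightarrow>\<^sub>M \<G> \<infinity>"
      using measurable_compose[OF measurable_Pair1' measurable_shift_pair] by simp
    moreover have "(\<lambda>\<omega>. ennreal (start_dying \<omega>)) \<in> borel_measurable (\<G> \<infinity>)"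
      by measurable
    ultimately have "?g \<omega> \<in> borel_measurable pos_lborel"
      by (rule measurable_compose)
    then show "(\<integral>\<^sup>+t. ?g \<omega> t \<partial>pos_lborel) = ennreal s * (\<integral>\<^sup>+t. ?g \<omega> (s * t) * indicator {..1} t \<partial>pos_lborel) + (\<integral>\<^sup>+t. ?g \<omega> (s + t) \<partial>pos_lborel)"
      by (rule nn_integral_pos_lborel_split[OF s])
  qed
  also have "\<dots> = ennreal s * (\<integral>\<^sup>+\<omega>. \<integral>\<^sup>+t. ?g \<omega> (s * t) * indicator {..1} t \<partial>pos_lborel \<partial>m)
      + (\<integral>\<^sup>+\<omega>. \<integral>\<^sup>+t. ?g \<omega> (s + t) \<partial>pos_lborel \<partial>m)"
    using meas2 meas3 by (simp add: nn_integral_add nn_integral_cmult)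
  finally show ?thesis
    unfolding 1 2 3 .
qed

end

text \<open>The initial value converges by right-continuity. The conditions at times 1 and 2 are
  eventually constant: positivity persists for a short while by right-continuity, and zero persists
  by absorption.\<close>

lemma start_dying_shift_tendsto:
  assumes \<omega>: "\<omega> \<in> cadlag_paths"
    and dead: "\<forall>s t. 0 < s \<longrightarrow> s \<le> t \<longrightarrow> \<omega> s = 0 \<longrightarrow> \<omega> t = 0"
  shows "((\<lambda>t. start_dying (shift_path t \<omega>)) \<longlongrightarrow> start_dying \<omega>) (at_right 0)"
proof -
  have right: "((\<lambda>t. \<omega> (r + t)) \<longlongrightarrow> \<omega> r) (at_right 0)" if "0 \<le> r" for r
  proof -
    have "(\<omega> \<longlongrightarrow> \<omega> r) (at_right r)"
      using \<omega> that by (simp add: cadlag_paths_def continuous_within)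
    then show ?thesis
      by (subst (asm) filterlim_at_right_to_0) (simp add: add.commute)
  qed
  have pos: "\<forall>\<^sub>F t in at_right (0::real). 0 < t"
    by (rule eventually_at_right_less)
  have nonneg: "0 \<le> \<omega> t" if "0 \<le> t" for t
    using \<omega> that by (simp add: cadlag_paths_def)
  have "\<forall>\<^sub>F t in at_right 0. 0 < \<omega> (1 + t) \<longleftrightarrow> 0 < \<omega> 1"
  proof (cases "0 < \<omega> 1")
    case True
    then show ?thesis
      using order_tendstoD(1)[OF right[of 1] True] by (auto elim: eventually_mono)
  next
    case False
    then have \<omega>1: "\<omega> 1 = 0" using nonneg[of 1] by simp
    show ?thesis
      using pos by eventually_elim (use \<omega>1 dead[rule_format, of 1] in auto)
  qed
  moreover have "\<forall>\<^sub>F t in at_right 0. \<omega> (2 + t) = 0 \<longleftrightarrow> \<omega> 2 = 0"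
  proof (cases "0 < \<omega> 2")
    case True
    then show ?thesis
      using order_tendstoD(1)[OF right[of 2] True] by (auto elim: eventually_mono)
  next
    case False
    then have \<omega>2: "\<omega> 2 = 0" using nonneg[of 2] by simp
    show ?thesis
      using pos by eventually_elim (use \<omega>2 dead[rule_format, of 2] in auto)
  qed
  ultimately have "\<forall>\<^sub>F t in at_right 0. min 1 (max 0 (\<omega> (0 + t))) * dying \<omega> = start_dying (shift_path t \<omega>)"
    using pos by eventually_elim (simp add: start_dying_def dying_def shift_path_def add.commute)
  moreover have "((\<lambda>t. min 1 (max 0 (\<omega> (0 + t))) * dying \<omega>) \<longlongrightarrow> min 1 (max 0 (\<omega> 0)) * dying \<omega>) (at_right 0)"
    by (intro tendsto_intros right) simp
  ultimately show ?thesis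
    unfolding start_dying_def[of \<omega>] by (rule Lim_transform_eventually[rotated])
qed

context selfsimilar_excursions
begin

text \<open>Dominated convergence. The integrands are bounded by the indicator of {X_1 > 0} times
  that of ]0, 1], because being alive at u + 1 implies being alive at 1; the bound has the finite
  integral m(X_1 > 0).\<close>

lemma initial_mean_tendsto:
  "(\<lambda>k. initial_mean (inverse (real (Suc k)))) \<longlonglongrightarrow> (\<integral>\<^sup>+\<omega>. ennreal (start_dying \<omega>) \<partial>m)"
proof -
  let ?I = "\<lambda>z. indicator {..1::real} (snd z) :: ennreal"
  have I [measurable]: "?I \<in> borel_measurable (m \<Otimes>\<^sub>M pos_lborel)"
    by (rule measurable_compose[OF measurable_snd_pos_lborel]) simp
  have start_\<G>: "(\<lambda>\<omega>. ennreal (start_dying \<omega>)) \<in> borel_measurable (\<G> \<infinity>)"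
    by measurable
  have start_m: "start_dying \<in> borel_measurable m"
    using measurable_start_dying by (simp add: measurable_cong_sets[OF sets_m refl])
  have start [measurable]: "(\<lambda>z. ennreal (start_dying (fst z))) \<in> borel_measurable (m \<Otimes>\<^sub>M pos_lborel)"
    using measurable_compose[OF measurable_fst start_m] by simp
  have alive_1: "(\<lambda>z. indicator {\<omega> \<in> space m. 0 < \<omega> 1} (fst z) * ?I z) \<in> borel_measurable (m \<Otimes>\<^sub>M pos_lborel)"
    by (intro borel_measurable_times_ennreal I measurable_compose[OF measurable_fst borel_measurable_indicator]) simp
  have unit: "(\<integral>\<^sup>+t. indicator {..1} t \<partial>pos_lborel) = 1"
  proof -
    have "(\<integral>\<^sup>+t. indicator {..1} t \<partial>pos_lborel) = (\<integral>\<^sup>+t. indicator {0<..1::real} t \<partial>lborel)"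
      unfolding nn_integral_pos_lborel by (intro nn_integral_cong) (auto simp: indicator_def)
    then show ?thesis by simp
  qed
  \<comment> \<open>Q is not assumed measurable, so the exceptional set is covered by the product of
    a null set with the time axis.\<close>
  have AE_pair: "AE z in m \<Otimes>\<^sub>M pos_lborel. Q (fst z)"
    if Q: "AE \<omega> in m. Q \<omega>" for Q
  proof -
    obtain N where N: "N \<in> null_sets m" "{\<omega> \<in> space m. \<not> Q \<omega>} \<subseteq> N"
      using Q by (auto simp: eventually_ae_filter)
    then have "emeasure (m \<Otimes>\<^sub>M pos_lborel) (N \<times> space pos_lborel) = 0"
      using time.M2.emeasure_pair_measure_Times[OF null_setsD2[OF N(1)] sets.top[of pos_lborel]]
        null_setsD1[OF N(1)]
      by simp
    then have "N \<times> space pos_lborel \<in> null_sets (m \<Otimes>\<^sub>M pos_lborel)"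
      by (intro null_setsI pair_measureI sets.top null_setsD2[OF N(1)])
    moreover have "{z \<in> space (m \<Otimes>\<^sub>M pos_lborel). \<not> Q (fst z)} \<subseteq> N \<times> space pos_lborel"
      using N by (auto simp: space_pair_measure)
    ultimately show ?thesis
      by (rule AE_I')
  qed
  have "(\<lambda>k. initial_mean (inverse (real (Suc k)))) \<longlonglongrightarrow>
      (\<integral>\<^sup>+z. ennreal (start_dying (fst z)) * ?I z \<partial>(m \<Otimes>\<^sub>M pos_lborel))"
    unfolding initial_mean_def
  proof (rule nn_integral_dominated_convergence)
    show "(\<lambda>z. ennreal (start_dying (shift_path (inverse (real (Suc k)) * snd z) (fst z))) * ?I z)
        \<in> borel_measurable (m \<Otimes>\<^sub>M pos_lborel)" for k
      by (intro borel_measurable_times_ennreal I measurable_compose[OF measurable_shift_scaled start_\<G>]) simp_all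
    show "(\<lambda>z. ennreal (start_dying (fst z)) * ?I z) \<in> borel_measurable (m \<Otimes>\<^sub>M pos_lborel)"
      by (intro borel_measurable_times_ennreal I start)
    show "(\<lambda>z. indicator {\<omega> \<in> space m. 0 < \<omega> 1} (fst z) * ?I z) \<in> borel_measurable (m \<Otimes>\<^sub>M pos_lborel)"
      by (rule alive_1)
    have "(\<integral>\<^sup>+z. indicator {\<omega> \<in> space m. 0 < \<omega> 1} (fst z) * ?I z \<partial>(m \<Otimes>\<^sub>M pos_lborel)) =
        (\<integral>\<^sup>+\<omega>. \<integral>\<^sup>+t. indicator {\<omega> \<in> space m. 0 < \<omega> 1} \<omega> * indicator {..1} t \<partial>pos_lborel \<partial>m)"
      by (subst time.M2.nn_integral_fst[OF alive_1, symmetric]) simp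
    also have "\<dots> = (\<integral>\<^sup>+\<omega>. indicator {\<omega> \<in> space m. 0 < \<omega> 1} \<omega> * (\<integral>\<^sup>+t. indicator {..1} t \<partial>pos_lborel) \<partial>m)"
      by (intro nn_integral_cong nn_integral_cmult) (auto intro!: measurable_restrict_space1)
    also have "\<dots> = emeasure m {\<omega> \<in> space m. 0 < \<omega> 1}"
      unfolding unit by simp
    finally show "(\<integral>\<^sup>+z. indicator {\<omega> \<in> space m. 0 < \<omega> 1} (fst z) * ?I z \<partial>(m \<Otimes>\<^sub>M pos_lborel)) < \<infinity>"
      using alive_finite[of 1] by simp
    show "AE z in m \<Otimes>\<^sub>M pos_lborel. ennreal (start_dying (shift_path (inverse (real (Suc k)) * snd z) (fst z))) * ?I z
        \<le> indicator {\<omega> \<in> space m. 0 < \<omega> 1} (fst z) * ?I z" for k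
      using AE_pair[OF alive_mono] AE_space
    proof eventually_elim
      case (elim z)
      define s where "s = inverse (real (Suc k)) * snd z"
      have z: "fst z \<in> space m" "0 < s"
        using elim(2) by (auto simp: s_def space_pair_measure space_restrict_space)
      then have "start_dying (shift_path s (fst z)) \<le> indicator {\<omega> \<in> space m. 0 < \<omega> 1} (fst z)"
        using elim(1)[rule_format, of 1 "s + 1"]
        by (auto simp: indicator_def start_dying_def dying_def shift_path_def)
      then have "ennreal (start_dying (shift_path s (fst z))) \<le> indicator {\<omega> \<in> space m. 0 < \<omega> 1} (fst z)"
        by (auto simp: indicator_def ennreal_eq_0_iff split: if_splits)
      then show ?case
        unfolding s_def by (rule mult_right_mono) simp
    qed
    show "AE z in m \<Otimes>\<^sub>M pos_lborel.
        (\<lambda>k. ennreal (start_dying (shift_path (inverse (real (Suc k)) * snd z) (fst z))) * ?I z)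
        \<longlonglongrightarrow> ennreal (start_dying (fst z)) * ?I z"
      using AE_pair[OF absorbed] AE_space
    proof eventually_elim
      case (elim z)
      then have z: "fst z \<in> cadlag_paths" "0 < snd z"
        by (auto simp: space_pair_measure space_restrict_space space_m)
      have "filterlim (\<lambda>k. inverse (real (Suc k)) * snd z) (at_right 0) sequentially"
        unfolding filterlim_at
        using tendsto_mult_left_zero[OF LIMSEQ_inverse_real_of_nat, of "snd z"] z
        by (auto simp: mult.commute)
      from filterlim_compose[OF start_dying_shift_tendsto[OF z(1) elim(1)] this]
      have "(\<lambda>k. start_dying (shift_path (inverse (real (Suc k)) * snd z) (fst z))) \<longlonglongrightarrow> start_dying (fst z)" .
      then show ?case
        by (auto simp: indicator_def intro: tendsto_ennrealI)
    qed
  qed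
  also have "(\<integral>\<^sup>+z. ennreal (start_dying (fst z)) * ?I z \<partial>(m \<Otimes>\<^sub>M pos_lborel)) =
      (\<integral>\<^sup>+\<omega>. \<integral>\<^sup>+t. ennreal (start_dying \<omega>) * indicator {..1} t \<partial>pos_lborel \<partial>m)"
    by (subst time.M2.nn_integral_fst[OF borel_measurable_times_ennreal[OF start I], symmetric]) simp
  also have "\<dots> = (\<integral>\<^sup>+\<omega>. ennreal (start_dying \<omega>) * (\<integral>\<^sup>+t. indicator {..1} t \<partial>pos_lborel) \<partial>m)"
    by (intro nn_integral_cong nn_integral_cmult) (auto intro!: measurable_restrict_space1)
  also have "\<dots> = (\<integral>\<^sup>+\<omega>. ennreal (start_dying \<omega>) \<partial>m)"
    unfolding unit by simp
  finally show ?thesis .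
qed

text \<open>Compare with a test function whose logarithmic integral is positive and finite. The
  potential of \<open>dying\<close> is positive and finite as well, and the product identity
  transfers both properties.\<close>

lemma log_integral_dying:
  assumes "emeasure m (space m) \<noteq> 0"
  shows "0 < log_integral ((1 - \<gamma>) / \<alpha>) (expect_from P dying)"
    and "log_integral ((1 - \<gamma>) / \<alpha>) (expect_from P dying) < \<infinity>"
proof -
  \<comment> \<open>Under exp the interval [1, e] becomes 0 \<le> s \<le> 1.\<close>
  let ?p = "(1 - \<gamma>) / \<alpha>" and ?f = "indicator {1..exp 1} :: real \<Rightarrow> ennreal"
  let ?L = "log_integral ?p ?f" and ?U = "\<integral>\<^sup>+z. ?f (fst z (snd z)) \<partial>(m \<Otimes>\<^sub>M pos_lborel)"
  have eq: "occupation m dying * ?L = ?U * log_integral ?p (expect_from P dying)"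
    by (intro occupation_log_integral measurable_dying dying_bounds) auto
  have f: "?f (exp s) = indicator {0..1} s" for s
    by (auto simp: indicator_def)
  have "?L \<le> (\<integral>\<^sup>+s. ennreal (exp \<bar>?p\<bar>) * indicator {0..1::real} s \<partial>lborel)"
    unfolding log_integral_def f
  proof (intro nn_integral_mono)
    fix s :: real
    have "?p * s \<le> \<bar>?p\<bar>" if "0 \<le> s" "s \<le> 1"
    proof -
      have "?p * s \<le> \<bar>?p\<bar> * s" using that by (intro mult_right_mono abs_ge_self)
      also have "\<dots> \<le> \<bar>?p\<bar>" using that by (intro mult_left_le) auto
      finally show ?thesis .
    qed
    then show "ennreal (exp (?p * s)) * indicator {0..1} s \<le> ennreal (exp \<bar>?p\<bar>) * indicator {0..1} s"
      by (auto simp: indicator_def intro!: ennreal_leI)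
  qed
  also have "\<dots> < \<infinity>"
    by (subst nn_integral_cmult_indicator) (auto simp: ennreal_mult_less_top)
  finally have L_fin: "?L < \<infinity>" .
  have L_pos: "?L \<noteq> 0"
  proof
    assume "?L = 0"
    then have "AE s in lborel. s \<notin> {0..1::real}"
      unfolding log_integral_def f by (subst (asm) nn_integral_0_iff_AE) (auto elim!: eventually_mono split: split_indicator_asm)
    then have "emeasure lborel {0..1::real} = 0"
      by (subst (asm) AE_iff_measurable[of "{0..1}"]) auto
    then show False by simp
  qed
  have "occupation m dying * ?L \<noteq> 0" "occupation m dying * ?L < \<infinity>"
    using occupation_dying_finite occupation_dying_pos[OF assms] L_fin L_pos
    by (auto simp: ennreal_mult_less_top)
  then show "0 < log_integral ?p (expect_from P dying)" "log_integral ?p (expect_from P dying) < \<infinity>"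
    unfolding eq by (auto simp: ennreal_mult_less_top zero_less_iff_neq_zero less_top ennreal_mult_eq_top_iff)
qed

text \<open>Apply the product identity to \<open>dying\<close> with f =
  \<open>expect_from P H\<close>, then divide by a positive finite number. The quotient in
  parentheses involves only P, \<alpha> and \<gamma>, so it is common to any two such
  measures.\<close>

lemma occupation_eq_log_integral:
  assumes "emeasure m (space m) \<noteq> 0" "H \<in> borel_measurable (\<G> \<infinity>)" "\<And>\<omega>. 0 \<le> H \<omega> \<and> H \<omega> \<le> 1"
  shows "occupation m H = occupation m dying *
    (log_integral ((1 - \<gamma>) / \<alpha>) (expect_from P H) / log_integral ((1 - \<gamma>) / \<alpha>) (expect_from P dying))"
proof -
  let ?l = "\<lambda>H. log_integral ((1 - \<gamma>) / \<alpha>) (expect_from P H)"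
  have "occupation m dying * ?l H = occupation m H * ?l dying"
    unfolding occupation_eq_expect_from[OF assms(2,3)]
    by (rule occupation_log_integral[OF measurable_dying measurable_expect_from[OF assms(2)] dying_bounds expect_from_nonpos])
  then have "occupation m dying * (?l H / ?l dying) = occupation m H * ?l dying / ?l dying"
    by (simp add: ennreal_times_divide)
  also have "\<dots> = occupation m H"
    using log_integral_dying[OF assms(1)] by (intro ennreal_mult_divide_eq) auto
  finally show ?thesis ..
qed

end

text \<open>Let c_i be the potential of \<open>dying\<close> and I_i the initial average under m_i.
  The splitting at s reads c_i A = s I_i + c_i B with A and B common to both measures. Eliminating
  them gives c_2 I_1 = c_1 I_2, and s tends to 0.\<close>

lemma proportional_start_dying:
  assumes m1: "selfsimilar_excursions m1 P \<alpha> \<gamma>" "emeasure m1 (space m1) \<noteq> 0"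
    and m2: "selfsimilar_excursions m2 P \<alpha> \<gamma>" "emeasure m2 (space m2) \<noteq> 0"
  shows "occupation m2 dying * (\<integral>\<^sup>+\<omega>. ennreal (start_dying \<omega>) \<partial>m1) =
         occupation m1 dying * (\<integral>\<^sup>+\<omega>. ennreal (start_dying \<omega>) \<partial>m2)"
proof -
  interpret m1: selfsimilar_excursions m1 P \<alpha> \<gamma> by fact
  interpret m2: selfsimilar_excursions m2 P \<alpha> \<gamma> by fact
  have "occupation m2 dying * m1.initial_mean s = occupation m1 dying * m2.initial_mean s" if s: "0 < s" for s
  proof -
    let ?S = "\<lambda>\<omega>. start_dying (shift_path s \<omega>)"
    have S: "?S \<in> borel_measurable (\<G> \<infinity>)"
      using measurable_compose[OF measurable_shift_path measurable_start_dying, of s] s by simp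
    define A where "A = log_integral ((1 - \<gamma>) / \<alpha>) (expect_from P start_dying) / log_integral ((1 - \<gamma>) / \<alpha>) (expect_from P dying)"
    define B where "B = log_integral ((1 - \<gamma>) / \<alpha>) (expect_from P ?S) / log_integral ((1 - \<gamma>) / \<alpha>) (expect_from P dying)"
    have A1: "occupation m1 dying * A = ennreal s * m1.initial_mean s + occupation m1 dying * B"
      unfolding A_def B_def
      unfolding m1.occupation_eq_log_integral[OF m1(2) measurable_start_dying start_dying_bounds, symmetric]
        m1.occupation_eq_log_integral[OF m1(2) S start_dying_bounds, symmetric]
      by (rule m1.occupation_start_dying_split[OF s])
    have A2: "occupation m2 dying * A = ennreal s * m2.initial_mean s + occupation m2 dying * B"
      unfolding A_def B_def
      unfolding m2.occupation_eq_log_integral[OF m2(2) measurable_start_dying start_dying_bounds, symmetric]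
        m2.occupation_eq_log_integral[OF m2(2) S start_dying_bounds, symmetric]
      by (rule m2.occupation_start_dying_split[OF s])
    \<comment> \<open>Cancelling a common summand in [0, \<infinity>] requires it to be finite. This
      follows from \<open>start_dying\<close> being at most \<open>dying\<close>, whose potential is
      finite.\<close>
    have "occupation m1 dying * B \<le> occupation m1 dying * A"
      unfolding A1 by simp
    also have "\<dots> = occupation m1 start_dying"
      unfolding A_def using m1.occupation_eq_log_integral[OF m1(2) measurable_start_dying] start_dying_bounds by simp
    also have "\<dots> \<le> occupation m1 dying"
      unfolding occupation_def
      by (intro nn_integral_mono mult_left_mono ennreal_leI start_dying_le_dying) simp
    also have "\<dots> < \<infinity>" by (rule m1.occupation_dying_finite)
    finally have fin: "occupation m2 dying * (occupation m1 dying * B) \<noteq> \<infinity>"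
      using m2.occupation_dying_finite ennreal_mult_less_top[of "occupation m2 dying" "occupation m1 dying * B"]
      by (simp add: less_top)
    have "occupation m2 dying * (occupation m1 dying * B) + ennreal s * (occupation m2 dying * m1.initial_mean s) =
        occupation m2 dying * (occupation m1 dying * A)"
      unfolding A1 by (simp add: distrib_left ac_simps)
    also have "\<dots> = occupation m1 dying * (occupation m2 dying * A)"
      by (simp add: ac_simps)
    also have "\<dots> = occupation m2 dying * (occupation m1 dying * B) + ennreal s * (occupation m1 dying * m2.initial_mean s)"
      unfolding A2 by (simp add: distrib_left ac_simps)
    finally have "ennreal s * (occupation m2 dying * m1.initial_mean s) = ennreal s * (occupation m1 dying * m2.initial_mean s)"
      using fin by (simp add: ennreal_add_left_cancel)
    then show ?thesis
      using s by (simp add: ennreal_mult_cancel_left)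
  qed
  then have eq: "(\<lambda>k. occupation m2 dying * m1.initial_mean (inverse (real (Suc k)))) =
      (\<lambda>k. occupation m1 dying * m2.initial_mean (inverse (real (Suc k))))"
    by (simp add: fun_eq_iff)
  have "(\<lambda>k. occupation m2 dying * m1.initial_mean (inverse (real (Suc k)))) \<longlonglongrightarrow>
      occupation m2 dying * (\<integral>\<^sup>+\<omega>. ennreal (start_dying \<omega>) \<partial>m1)"
    using m2.occupation_dying_finite m2.occupation_dying_pos[OF m2(2)]
    by (intro tendsto_mult_ennreal tendsto_const m1.initial_mean_tendsto) auto
  moreover have "(\<lambda>k. occupation m2 dying * m1.initial_mean (inverse (real (Suc k)))) \<longlonglongrightarrow>
      occupation m1 dying * (\<integral>\<^sup>+\<omega>. ennreal (start_dying \<omega>) \<partial>m2)"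
    unfolding eq using m1.occupation_dying_finite m1.occupation_dying_pos[OF m1(2)]
    by (intro tendsto_mult_ennreal tendsto_const m2.initial_mean_tendsto) auto
  ultimately show ?thesis
    by (rule LIMSEQ_unique)
qed

section \<open>Restrictions of an excursion measure\<close>

text \<open>A zero at t bounds T_0 by t, and conversely the path stays at 0 from T_0 on. This
  replaces T_0 by a measurable coordinate event on the carrier of an excursion measure.\<close>

lemma hit_zero_less_iff:
  assumes "\<omega> \<in> cadlag_paths" "\<forall>t\<ge>0. T\<^sub>0 \<omega> \<le> ennreal t \<longrightarrow> \<omega> t = 0" "0 < t"
  shows "ennreal t < T\<^sub>0 \<omega> \<longleftrightarrow> 0 < \<omega> t"
proof
  assume "ennreal t < T\<^sub>0 \<omega>"
  moreover have "T\<^sub>0 \<omega> \<le> ennreal t" if "\<omega> t = 0"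
    unfolding hit_zero_def using that \<open>0 < t\<close> by (intro Inf_lower) auto
  ultimately show "0 < \<omega> t"
    using assms by (force simp: cadlag_paths_def less_le)
next
  assume "0 < \<omega> t"
  then show "ennreal t < T\<^sub>0 \<omega>"
    using assms(2)[rule_format, of t] \<open>0 < t\<close> by (cases "T\<^sub>0 \<omega> \<le> ennreal t") auto
qed

text \<open>Chebyshev's inequality: on {t < T_0} the integrable function 1 - exp (- T_0) is at least
  1 - exp (- t) > 0.\<close>

lemma excursion_alive_finite:
  assumes n: "excursion_measure P n" and t: "0 < t"
  shows "emeasure n {\<omega> \<in> space n. 0 < \<omega> t} < \<infinity>"
proof -
  have sets_n [measurable_cong]: "sets n = sets (\<G> \<infinity>)"
    and good: "AE \<omega> in n. 0 < T\<^sub>0 \<omega> \<and> (\<forall>t\<ge>0. T\<^sub>0 \<omega> \<le> ennreal t \<longrightarrow> \<omega> t = 0)"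
    and fin: "(\<integral>\<^sup>+ \<omega>. ennreal (one_minus_exp (T\<^sub>0 \<omega>)) \<partial>completion n) < \<infinity>"
    using n by (auto simp: excursion_measure_def)
  have space_n: "space n = cadlag_paths"
    using sets_eq_imp_space_eq[OF sets_n] by simp
  have [measurable]: "(\<lambda>\<omega>. \<omega> t) \<in> borel_measurable n"
    using measurable_coordinate[of t \<infinity>] t by (simp add: measurable_cong_sets[OF sets_n refl])
  have "ennreal (1 - exp (- t)) * emeasure n {\<omega> \<in> space n. 0 < \<omega> t} =
      (\<integral>\<^sup>+\<omega>. ennreal (1 - exp (- t)) * indicator {\<omega> \<in> space n. 0 < \<omega> t} \<omega> \<partial>n)"
    by (rule nn_integral_cmult_indicator[symmetric]) measurable
  also have "\<dots> \<le> (\<integral>\<^sup>+ \<omega>. ennreal (one_minus_exp (T\<^sub>0 \<omega>)) \<partial>n)"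
  proof (rule nn_integral_mono_AE)
    show "AE \<omega> in n. ennreal (1 - exp (- t)) * indicator {\<omega> \<in> space n. 0 < \<omega> t} \<omega> \<le> ennreal (one_minus_exp (T\<^sub>0 \<omega>))"
      using good AE_space
    proof eventually_elim
      case (elim \<omega>)
      have "1 - exp (- t) \<le> one_minus_exp (T\<^sub>0 \<omega>)" if "ennreal t < T\<^sub>0 \<omega>"
      proof (cases "T\<^sub>0 \<omega>")
        case (real r)
        then have "t < r" using that t by (simp add: ennreal_less_iff)
        then show ?thesis using real t by (simp add: one_minus_exp_def)
      qed (simp add: one_minus_exp_def)
      then show ?case
        using hit_zero_less_iff[of \<omega> t] elim t
        by (auto simp: indicator_def space_n intro!: ennreal_leI)
    qed
  qed
  also have "\<dots> < \<infinity>"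
    using fin by (simp add: nn_integral_completion)
  finally show ?thesis
    using t by (auto simp: ennreal_mult_less_top)
qed

text \<open>Translates the Markov property from Bochner integrals over the completion to nonnegative
  integrals over n. The event {t < T_0} differs from the measurable event {X_t > 0} only by a null
  set.\<close>

lemma excursion_markov:
  assumes n: "excursion_measure P n"
    and kernel: "P \<in> restrict_space borel {0..} \<rightarrow>\<^sub>M prob_algebra (\<G> \<infinity>)"
    and t: "0 < t" and W: "W \<in> sets (\<G> (ennreal t))"
    and H [measurable]: "H \<in> borel_measurable (\<G> \<infinity>)" and H01: "\<And>\<omega>. 0 \<le> H \<omega> \<and> H \<omega> \<le> 1"
  shows "(\<integral>\<^sup>+\<omega>. indicator W \<omega> * (indicator {0<..} (\<omega> t) * ennreal (H (shift_path t \<omega>))) \<partial>n) =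
    (\<integral>\<^sup>+\<omega>. indicator W \<omega> * (indicator {0<..} (\<omega> t) * (\<integral>\<^sup>+\<eta>. ennreal (H \<eta>) \<partial>P (\<omega> t))) \<partial>n)"
proof -
  have sets_n [measurable_cong]: "sets n = sets (\<G> \<infinity>)"
    and good: "AE \<omega> in n. 0 < T\<^sub>0 \<omega> \<and> (\<forall>t\<ge>0. T\<^sub>0 \<omega> \<le> ennreal t \<longrightarrow> \<omega> t = 0)"
    using n by (auto simp: excursion_measure_def)
  have space_n: "space n = cadlag_paths"
    using sets_eq_imp_space_eq[OF sets_n] by simp
  have at_t [measurable]: "(\<lambda>\<omega>. \<omega> t) \<in> borel_measurable n"
    using measurable_coordinate[of t \<infinity>] t by (simp add: measurable_cong_sets[OF sets_n refl])
  have W_sub: "W \<subseteq> cadlag_paths"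
    using sets.sets_into_space[OF W] by simp
  have W_n [measurable]: "W \<in> sets n"
    using W filtration.sets_F_mono[OF filtration_natural_filtration, of "ennreal t" \<infinity>] sets_n by auto
  have fin: "emeasure n {\<omega> \<in> space n. 0 < \<omega> t} < \<infinity>"
    by (rule excursion_alive_finite[OF n t])
  let ?A = "W \<inter> {\<omega>. ennreal t < T\<^sub>0 \<omega>}" and ?B = "{\<omega> \<in> space n. \<omega> \<in> W \<and> 0 < \<omega> t}"
  have AB: "AE \<omega> in completion n. \<omega> \<in> ?B \<longleftrightarrow> \<omega> \<in> ?A"
    using AE_completion[OF good] AE_space
  proof eventually_elim
    case (elim \<omega>)
    then show ?case
      using hit_zero_less_iff[of \<omega> t] t by (auto simp: space_n)
  qed
  have "?B \<in> sets n"
    by measurable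
  then have B: "?B \<in> sets (completion n)"
    by (rule sets_completionI_sets)
  have A: "?A \<in> sets (completion n)"
    by (rule completion.in_sets_AE[OF AB B]) (use W_sub in \<open>auto simp: space_n\<close>)
  have conv: "ennreal (LINT \<omega> : ?A | completion n. F \<omega>) =
      (\<integral>\<^sup>+\<omega>. indicator W \<omega> * (indicator {0<..} (\<omega> t) * ennreal (F \<omega>)) \<partial>n)"
    if [measurable]: "F \<in> borel_measurable n" and F: "\<And>\<omega>. \<omega> \<in> space n \<Longrightarrow> 0 \<le> F \<omega> \<and> F \<omega> \<le> 1" for F :: "path \<Rightarrow> real"
  proof -
    have "(LINT \<omega> : ?A | completion n. F \<omega>) = (LINT \<omega> | completion n. indicator ?B \<omega> *\<^sub>R F \<omega>)"
      unfolding set_lebesgue_integral_def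
    proof (rule integral_cong_AE)
      show "(\<lambda>\<omega>. indicator ?A \<omega> *\<^sub>R F \<omega>) \<in> borel_measurable (completion n)"
        by (intro borel_measurable_scaleR borel_measurable_indicator A measurable_completion that)
      show "(\<lambda>\<omega>. indicator ?B \<omega> *\<^sub>R F \<omega>) \<in> borel_measurable (completion n)"
        by (intro measurable_completion) measurable
      show "AE \<omega> in completion n. indicator ?A \<omega> *\<^sub>R F \<omega> = indicator ?B \<omega> *\<^sub>R F \<omega>"
        using AB by eventually_elim (auto simp: indicator_def)
    qed
    also have "\<dots> = (LINT \<omega> | n. indicator ?B \<omega> *\<^sub>R F \<omega>)"
      by (rule integral_completion) measurable
    finally have "ennreal (LINT \<omega> : ?A | completion n. F \<omega>) = ennreal (LINT \<omega> | n. indicator ?B \<omega> *\<^sub>R F \<omega>)"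
      by simp
    also have "\<dots> = (\<integral>\<^sup>+\<omega>. ennreal (indicator ?B \<omega> *\<^sub>R F \<omega>) \<partial>n)"
    proof (rule nn_integral_eq_integral[symmetric])
      \<comment> \<open>The integrand is bounded by 1 and lives on a set of finite mass. Without
        integrability the Bochner integral would take the default value 0.\<close>
      have "integrable n (indicator {\<omega> \<in> space n. 0 < \<omega> t} :: path \<Rightarrow> real)"
        using fin by (intro integrable_real_indicator) auto
      then show "integrable n (\<lambda>\<omega>. indicator ?B \<omega> *\<^sub>R F \<omega>)"
        by (rule Bochner_Integration.integrable_bound) (use F in \<open>auto simp: indicator_def intro!: AE_I2\<close>)
      show "AE \<omega> in n. 0 \<le> indicator ?B \<omega> *\<^sub>R F \<omega>"
        using F by (intro AE_I2) (auto simp: indicator_def)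
    qed
    also have "\<dots> = (\<integral>\<^sup>+\<omega>. indicator W \<omega> * (indicator {0<..} (\<omega> t) * ennreal (F \<omega>)) \<partial>n)"
      by (intro nn_integral_cong) (auto simp: indicator_def)
    finally show ?thesis .
  qed
  have P: "prob_space (P y)" "sets (P y) = sets (\<G> \<infinity>)" if "0 \<le> y" for y
    using measurable_space[OF kernel, of y] that by (auto simp: space_prob_algebra space_restrict_space)
  have mean: "0 \<le> (LINT \<eta> | P y. H \<eta>) \<and> (LINT \<eta> | P y. H \<eta>) \<le> 1"
    "ennreal (LINT \<eta> | P y. H \<eta>) = (\<integral>\<^sup>+\<eta>. ennreal (H \<eta>) \<partial>P y)" if y: "0 \<le> y" for y
  proof -
    interpret prob_space "P y" by (rule P[OF y])
    have "H \<in> borel_measurable (P y)"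
      using H by (simp add: measurable_cong_sets[OF P(2)[OF y] refl])
    then have int: "integrable (P y) H"
      by (rule integrable_const_bound[where B = 1, rotated]) (use H01 in auto)
    show "0 \<le> (LINT \<eta> | P y. H \<eta>) \<and> (LINT \<eta> | P y. H \<eta>) \<le> 1"
      using int H01 by (auto intro!: integral_nonneg integral_le_const)
    show "ennreal (LINT \<eta> | P y. H \<eta>) = (\<integral>\<^sup>+\<eta>. ennreal (H \<eta>) \<partial>P y)"
      using int H01 by (intro nn_integral_eq_integral[symmetric]) auto
  qed
  have nonneg: "0 \<le> \<omega> t" if "\<omega> \<in> space n" for \<omega>
    using that t by (simp add: space_n cadlag_paths_def)
  have shift: "(\<lambda>\<omega>. H (shift_path t \<omega>)) \<in> borel_measurable n"
    using measurable_compose[OF measurable_shift_path H, of t] t by (simp add: measurable_cong_sets[OF sets_n refl])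
  have "(\<lambda>\<omega>. \<omega> t) \<in> n \<rightarrow>\<^sub>M restrict_space borel {0..}"
    using nonneg by (intro measurable_restrict_space2) auto
  moreover have "(\<lambda>y. LINT \<eta> | P y. H \<eta>) \<in> borel_measurable (restrict_space borel {0..})"
    by (rule measurable_compose[OF measurable_prob_algebraD[OF kernel] integral_measurable_subprob_algebra[OF H]])
  ultimately have after: "(\<lambda>\<omega>. LINT \<eta> | P (\<omega> t). H \<eta>) \<in> borel_measurable n"
    by (rule measurable_compose)
  have "bounded_measurable H"
    unfolding bounded_measurable_def bounded_iff using H H01 by (auto intro!: exI[of _ 1])
  then have "(LINT \<omega> : ?A | completion n. H (shift_path t \<omega>)) = (LINT \<omega> : ?A | completion n. (LINT \<eta> | P (\<omega> t). H \<eta>))"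
    using n W t unfolding excursion_measure_def by blast
  then have "(\<integral>\<^sup>+\<omega>. indicator W \<omega> * (indicator {0<..} (\<omega> t) * ennreal (H (shift_path t \<omega>))) \<partial>n) =
     (\<integral>\<^sup>+\<omega>. indicator W \<omega> * (indicator {0<..} (\<omega> t) * ennreal (LINT \<eta> | P (\<omega> t). H \<eta>)) \<partial>n)"
    using conv[OF shift] conv[OF after] H01 mean(1)[OF nonneg] by simp
  also have "\<dots> = (\<integral>\<^sup>+\<omega>. indicator W \<omega> * (indicator {0<..} (\<omega> t) * (\<integral>\<^sup>+\<eta>. ennreal (H \<eta>) \<partial>P (\<omega> t))) \<partial>n)"
    using mean(2)[OF nonneg] by (intro nn_integral_cong) simp
  finally show ?thesis .
qed

text \<open>An event of \<open>\<G> 0\<close> lies in every \<open>\<G> t\<close>, so the Markov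
  property may be localised to it at all times; its scale invariance lets its indicator pass through
  the scaling map. Using \<open>density\<close> rather than a subspace keeps the path space and its
  sets unchanged.\<close>

lemma selfsimilar_excursions_restrict:
  assumes X: "pssMp \<alpha> P" and \<gamma>: "0 < \<gamma>"
    and n: "excursion_measure P n" and ss: "self_similar_measure \<alpha> \<gamma> n"
    and W: "W \<in> sets (\<G> 0)"
    and inv: "\<And>a \<omega>. 0 < a \<Longrightarrow> \<omega> \<in> cadlag_paths \<Longrightarrow> scale_path \<alpha> a \<omega> \<in> W \<longleftrightarrow> \<omega> \<in> W"
  shows "selfsimilar_excursions (density n (indicator W)) P \<alpha> \<gamma>"
proof -
  have kernel: "P \<in> restrict_space borel {0..} \<rightarrow>\<^sub>M prob_algebra (\<G> \<infinity>)" and \<alpha>: "0 < \<alpha>"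
    using X by (auto simp: pssMp_def strong_markov_def)
  have sets_n [measurable_cong]: "sets n = sets (\<G> \<infinity>)"
    and good: "AE \<omega> in n. 0 < T\<^sub>0 \<omega> \<and> (\<forall>t\<ge>0. T\<^sub>0 \<omega> \<le> ennreal t \<longrightarrow> \<omega> t = 0)"
    and sf: "sigma_finite_measure n"
    using n by (auto simp: excursion_measure_def)
  have space_n: "space n = cadlag_paths"
    using sets_eq_imp_space_eq[OF sets_n] by simp
  have W_t: "W \<in> sets (\<G> t)" for t
    using W filtration.sets_F_mono[OF filtration_natural_filtration, of 0 t] by auto
  have W_n [measurable]: "W \<in> sets n"
    using W_t[of \<infinity>] sets_n by simp
  interpret n: sigma_finite_measure n by fact
  let ?m = "density n (indicator W)"
  have meas: "f \<in> borel_measurable n" if "f \<in> borel_measurable (\<G> \<infinity>)" for f :: "path \<Rightarrow> ennreal"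
    using that by (simp add: measurable_cong_sets[OF sets_n refl])
  show ?thesis
  proof (intro selfsimilar_excursions.intro selfsimilar_excursions_axioms.intro)
    show "sigma_finite_measure ?m"
      by (subst n.sigma_finite_iff_density_finite) (auto simp: indicator_def)
    show "sets ?m = sets (\<G> \<infinity>)" by (simp add: sets_n)
    show "0 < \<alpha>" "0 < \<gamma>" "P \<in> restrict_space borel {0..} \<rightarrow>\<^sub>M prob_algebra (\<G> \<infinity>)" by fact+
    have "AE \<omega> in n. \<exists>t>0. 0 < \<omega> t"
      using good AE_space
    proof eventually_elim
      case (elim \<omega>)
      then obtain e where e: "0 < e" "e < T\<^sub>0 \<omega>"
        using dense by blast
      then have "e \<noteq> \<infinity>" by auto
      then obtain t where "e = ennreal t" "0 < t"
        using e(1) by (cases e) auto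
      then show ?case
        using hit_zero_less_iff[of \<omega> t] elim e by (auto simp: space_n)
    qed
    then show "AE \<omega> in ?m. \<exists>t>0. 0 < \<omega> t"
      by (subst AE_density) auto
    have "AE \<omega> in n. \<forall>s t. 0 < s \<longrightarrow> s \<le> t \<longrightarrow> \<omega> s = 0 \<longrightarrow> \<omega> t = 0"
      using good AE_space
    proof eventually_elim
      case (elim \<omega>)
      show ?case
      proof safe
        fix s t :: real assume st: "0 < s" "s \<le> t" "\<omega> s = 0"
        then have "T\<^sub>0 \<omega> \<le> ennreal s"
          using hit_zero_less_iff[of \<omega> s] elim by (auto simp: space_n not_less)
        also have "\<dots> \<le> ennreal t"
          using st by (intro ennreal_leI)
        finally show "\<omega> t = 0"
          using elim st by auto
      qed
    qed
    then show "AE \<omega> in ?m. \<forall>s t. 0 < s \<longrightarrow> s \<le> t \<longrightarrow> \<omega> s = 0 \<longrightarrow> \<omega> t = 0"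
      by (subst AE_density) auto
  next
    fix t :: real assume t: "0 < t"
    have [measurable]: "(\<lambda>\<omega>. \<omega> t) \<in> borel_measurable n"
      using measurable_coordinate[of t \<infinity>] t by (simp add: measurable_cong_sets[OF sets_n refl])
    have "emeasure ?m {\<omega> \<in> space ?m. 0 < \<omega> t} = (\<integral>\<^sup>+\<omega>. indicator W \<omega> * indicator {\<omega> \<in> space n. 0 < \<omega> t} \<omega> \<partial>n)"
      by (subst emeasure_density) auto
    also have "\<dots> \<le> (\<integral>\<^sup>+\<omega>. indicator {\<omega> \<in> space n. 0 < \<omega> t} \<omega> \<partial>n)"
      by (intro nn_integral_mono) (auto simp: indicator_def)
    also have "\<dots> = emeasure n {\<omega> \<in> space n. 0 < \<omega> t}"
      by (rule nn_integral_indicator) measurable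
    also have "\<dots> < \<infinity>" by (rule excursion_alive_finite[OF n t])
    finally show "emeasure ?m {\<omega> \<in> space ?m. 0 < \<omega> t} < \<infinity>" .
  next
    fix H :: "path \<Rightarrow> real" and t :: real
    assume H [measurable]: "H \<in> borel_measurable (\<G> \<infinity>)" and H01: "\<And>\<omega>. 0 \<le> H \<omega> \<and> H \<omega> \<le> 1" and t: "0 < t"
    have at_t [measurable]: "(\<lambda>\<omega>. \<omega> t) \<in> borel_measurable n"
      using measurable_coordinate[of t \<infinity>] t by (simp add: measurable_cong_sets[OF sets_n refl])
    have [measurable]: "shift_path t \<in> n \<rightarrow>\<^sub>M \<G> \<infinity>"
      using measurable_shift_path[of t] t by (simp add: measurable_cong_sets[OF sets_n refl])
    have "(\<lambda>\<omega>. \<omega> t) \<in> n \<rightarrow>\<^sub>M restrict_space borel {0..}"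
      using t by (intro measurable_restrict_space2) (auto simp: space_n cadlag_paths_def)
    moreover have "(\<lambda>y. \<integral>\<^sup>+\<eta>. ennreal (H \<eta>) \<partial>P y) \<in> borel_measurable (restrict_space borel {0..})"
      by (rule measurable_compose[OF measurable_prob_algebraD[OF kernel] nn_integral_measurable_subprob_algebra])
         measurable
    ultimately have mean: "(\<lambda>\<omega>. \<integral>\<^sup>+\<eta>. ennreal (H \<eta>) \<partial>P (\<omega> t)) \<in> borel_measurable n"
      by (rule measurable_compose)
    have alive: "(\<lambda>\<omega>. indicator {0<..} (\<omega> t) :: ennreal) \<in> borel_measurable n"
      by measurable
    have shift: "(\<lambda>\<omega>. ennreal (H (shift_path t \<omega>))) \<in> borel_measurable n"
      by measurable
    show "(\<integral>\<^sup>+\<omega>. indicator {0<..} (\<omega> t) * ennreal (H (shift_path t \<omega>)) \<partial>?m) =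
      (\<integral>\<^sup>+\<omega>. indicator {0<..} (\<omega> t) * (\<integral>\<^sup>+\<eta>. ennreal (H \<eta>) \<partial>P (\<omega> t)) \<partial>?m)"
      using excursion_markov[OF n kernel t W_t H H01]
      by (simp only: nn_integral_density[OF borel_measurable_indicator[OF W_n] borel_measurable_times_ennreal[OF alive shift]]
          nn_integral_density[OF borel_measurable_indicator[OF W_n] borel_measurable_times_ennreal[OF alive mean]])
  next
    fix a :: real and F :: "path \<Rightarrow> ennreal" assume a: "0 < a" and F: "F \<in> borel_measurable (\<G> \<infinity>)"
    let ?G = "\<lambda>\<omega>. indicator W \<omega> * F \<omega>"
    have G: "?G \<in> borel_measurable (\<G> \<infinity>)"
      using F W_t[of \<infinity>] by measurable
    have scale: "scale_path \<alpha> a \<in> n \<rightarrow>\<^sub>M \<G> \<infinity>"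
      using measurable_scale_path[OF a] by (simp add: measurable_cong_sets[OF sets_n refl])
    have "(\<integral>\<^sup>+\<omega>. F (scale_path \<alpha> a \<omega>) \<partial>?m) = (\<integral>\<^sup>+\<omega>. indicator W \<omega> * F (scale_path \<alpha> a \<omega>) \<partial>n)"
      using measurable_compose[OF scale F] by (subst nn_integral_density) auto
    also have "\<dots> = (\<integral>\<^sup>+\<omega>. ?G (scale_path \<alpha> a \<omega>) \<partial>n)"
      using inv[OF a] by (intro nn_integral_cong) (simp add: space_n indicator_def)
    also have "\<dots> = (\<integral>\<^sup>+\<omega>. ?G \<omega> \<partial>distr n (\<G> \<infinity>) (scale_path \<alpha> a))"
      using G by (subst nn_integral_distr[OF scale]) simp_all
    also have "\<dots> = (\<integral>\<^sup>+\<omega>. ?G \<omega> \<partial>scale_measure (ennreal (a powr (\<gamma> / \<alpha>))) n)"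
      using ss a by (simp add: self_similar_measure_def)
    also have "\<dots> = ennreal (a powr (\<gamma> / \<alpha>)) * (\<integral>\<^sup>+\<omega>. ?G \<omega> \<partial>n)"
      by (rule nn_integral_scale_measure[OF meas[OF G]])
    also have "(\<integral>\<^sup>+\<omega>. ?G \<omega> \<partial>n) = (\<integral>\<^sup>+\<omega>. F \<omega> \<partial>?m)"
      using meas[OF F] by (subst nn_integral_density) auto
    finally show "(\<integral>\<^sup>+\<omega>. F (scale_path \<alpha> a \<omega>) \<partial>?m) = ennreal (a powr (\<gamma> / \<alpha>)) * (\<integral>\<^sup>+\<omega>. F \<omega> \<partial>?m)" .
  qed
qed

section \<open>The dichotomy for the starting value\<close>

theorem lemma1:
  fixes \<alpha> \<gamma> :: real and P :: "real \<Rightarrow> path measure" and n :: "path measure"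
  assumes "pssMp \<alpha> P" and "dies_at_zero P"
    and "0 < \<gamma>" and "\<gamma> < 1"
    and "excursion_measure P n" and "self_similar_measure \<alpha> \<gamma> n"
  shows "emeasure n {\<omega> \<in> space n. X\<^sub>0\<^sub>+ \<omega> > 0} = 0 \<or>
         emeasure n {\<omega> \<in> space n. X\<^sub>0\<^sub>+ \<omega> = 0} = 0"
proof (rule ccontr)
  assume contra: "\<not> ?thesis"
  have sets_n [measurable_cong]: "sets n = sets (\<G> \<infinity>)"
    using assms(5) by (simp add: excursion_measure_def)
  have space_n: "space n = cadlag_paths"
    using sets_eq_imp_space_eq[OF sets_n] by simp
  define W where "W B = {\<omega> \<in> cadlag_paths. \<omega> 0 \<in> B}" for B :: "real set"
  \<comment> \<open>Both ]0, \<infinity>[ and {0} are stable under multiplication by a > 0 and by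
    its inverse, which makes the corresponding events scale invariant.\<close>
  have W: "selfsimilar_excursions (density n (indicator (W B))) P \<alpha> \<gamma>" "W B \<in> sets n"
    if "B \<in> {{0<..}, {0}}" for B
  proof -
    have B: "W B \<in> sets (\<G> t)" for t
      using that measurable_sets[OF measurable_coordinate[of 0 t], of B]
      by (auto simp: W_def vimage_def Int_def conj_commute)
    have "scale_path \<alpha> a \<omega> \<in> W B \<longleftrightarrow> \<omega> \<in> W B" if "0 < a" "\<omega> \<in> cadlag_paths" for a \<omega>
      using measurable_space[OF measurable_scale_path[OF that(1)], of \<omega>] that \<open>B \<in> _\<close>
      by (auto simp: W_def scale_path_def zero_less_mult_iff)
    then show "selfsimilar_excursions (density n (indicator (W B))) P \<alpha> \<gamma>"
      using assms B by (intro selfsimilar_excursions_restrict)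
    show "W B \<in> sets n" using B[of \<infinity>] by (simp add: sets_n)
  qed
  have sets_W [measurable]: "W {0<..} \<in> sets n" "W {0} \<in> sets n"
    by (auto intro: W(2))
  define m1 where "m1 = density n (indicator (W {0<..}))"
  define m2 where "m2 = density n (indicator (W {0}))"
  have X: "{\<omega> \<in> space n. X\<^sub>0\<^sub>+ \<omega> > 0} = W {0<..}" "{\<omega> \<in> space n. X\<^sub>0\<^sub>+ \<omega> = 0} = W {0}"
    by (auto simp: W_def space_n right_limit_0_eq)
  have W_space: "W B \<inter> space n = W B" for B
    by (auto simp: W_def space_n)
  have nonzero: "emeasure m1 (space m1) \<noteq> 0" "emeasure m2 (space m2) \<noteq> 0"
    using contra unfolding X m1_def m2_def
    by (simp_all add: emeasure_density W_space flip: indicator_inter_arith)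
  have m1: "selfsimilar_excursions m1 P \<alpha> \<gamma>" and m2: "selfsimilar_excursions m2 P \<alpha> \<gamma>"
    unfolding m1_def m2_def by (auto intro: W(1))
  interpret m1: selfsimilar_excursions m1 P \<alpha> \<gamma> by (rule m1)
  interpret m2: selfsimilar_excursions m2 P \<alpha> \<gamma> by (rule m2)
  have [measurable]: "start_dying \<in> borel_measurable n"
    using measurable_start_dying by (simp add: measurable_cong_sets[OF sets_n refl])
  \<comment> \<open>G vanishes on paths that start at 0. Proportionality with a positive constant
    then forces m1(G) = 0.\<close>
  have "(\<integral>\<^sup>+\<omega>. ennreal (start_dying \<omega>) \<partial>m2) = (\<integral>\<^sup>+\<omega>. indicator (W {0}) \<omega> * ennreal (start_dying \<omega>) \<partial>n)"
    unfolding m2_def by (rule nn_integral_density) measurable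
  also have "\<dots> = (\<integral>\<^sup>+\<omega>. 0 \<partial>n)"
    by (intro nn_integral_cong) (auto simp: W_def start_dying_def indicator_def)
  finally have "occupation m2 dying * (\<integral>\<^sup>+\<omega>. ennreal (start_dying \<omega>) \<partial>m1) = 0"
    using proportional_start_dying[OF m1 nonzero(1) m2 nonzero(2)] by simp
  then have "(\<integral>\<^sup>+\<omega>. ennreal (start_dying \<omega>) \<partial>m1) = 0"
    using m2.occupation_dying_pos[OF nonzero(2)] by auto
  then have "AE \<omega> in m1. start_dying \<omega> \<le> 0"
    by (subst (asm) nn_integral_0_iff_AE) (auto simp: ennreal_eq_0_iff)
  \<comment> \<open>As almost every path under m1 starts above 0, G can vanish only through its
    factor \<open>dying\<close>. This contradicts the positive mass of {1 < T_0 \<le> 2} under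
    m1.\<close>
  moreover have "AE \<omega> in m1. 0 < \<omega> 0"
    unfolding m1_def
    by (subst AE_density[OF borel_measurable_indicator[OF sets_W(1)]]) (auto simp: W_def indicator_def)
  ultimately have "AE \<omega> in m1. \<not> (0 < \<omega> 1 \<and> \<omega> 2 = 0)"
    by eventually_elim (auto simp: start_dying_def dying_def)
  from emeasure_eq_0_AE[OF this] m1.dying_between_pos[OF nonzero(1), of 1 2]
  show False by simp
qed

end
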